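(* Under the hypotheses of Theorem 6 (in the setting below), let $n=|V|$, let $\psi(\phi)$ denote the sum of the inverse Born series for $\|\phi\|_p<r_p$, and let $M=\sup_{\|\phi\|_p<r_p}\|\psi(\phi)\|_p$ (which is finite). Let $0<\tau<1$ and let $\phi\in\mathbb{C}^{R\times S}$ with $\|\phi\|_p<\tau r_p$. Then for every $N\ge1$, $$\Big\|\psi(\phi)-\sum_{m=1}^N\mathcal K_m(\phi,\dots,\phi)\Big\|_\infty\le M\Big(\frac{1}{1-\tau}\Big)^n\Big(\frac{\|\phi\|_p}{\tau r_p}\Big)^N\frac{1}{1-\frac{\|\phi\|_p}{\tau r_p}}.$$ In particular this bounds $\|\eta-\sum_{m=1}^N\mathcal K_m(\phi,\dots,\phi)\|_\infty$ when $\eta$ is the potential with $\|\eta\|_p<R_*$ whose scattering data is $\phi$.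
   Context: Setting: Let $V$ and $\delta V$ be finite disjoint sets (interior and boundary vertices of a graph), let $R,S\subseteq\delta V$ be nonempty (receivers and sources), let $\alpha_0>0$, and let $G_0$ (the background Green's function) be a complex matrix with rows and columns indexed by $V\cup\delta V$. For $U,W\subseteq V\cup\delta V$, $G_0^{U;W}$ is the submatrix with rows indexed by $U$ and columns by $W$. For $a\in\mathbb{C}^V$, $D_a$ is the diagonal $V\times V$ matrix with diagonal $a$. For $j\ge1$ define the multilinear map $K_j:(\mathbb{C}^V)^j\to\mathbb{C}^{R\times S}$ by $$K_j(\eta_1,\dots,\eta_j)(r,s)=(-1)^{j+1}\alpha_0^{\,j}\,G_0^{r;V}D_{\eta_1}G_0^{V;V}D_{\eta_2}\cdots G_0^{V;V}D_{\eta_j}G_0^{V;s},\qquad r\in R,\ s\in S.$$ Fix $p,q\in[1,\infty]$ with $1/p+1/q=1$; $\|\cdot\|_p$ is the $\ell^p$ norm on $\mathbb{C}^V$ and on $\mathbb{C}^{R\times S}$. Define $\nu_p=\alpha_0\big(\sum_{r\in R}\|G_0^{r;V}\|_{\ell^q(V)}^p\big)^{1/p}\big(\sum_{s\in S}\|G_0^{V;s}\|_{\ell^q(V)}^p\big)^{1/p}$ and $\mu_p=\alpha_0\max_{v\in V}\|G_0^{v;V}\|_{\ell^q(V)}$. Hypotheses of Theorem 6: $|V|=|R\times S|$, $K_1:\mathbb{C}^V\to\mathbb{C}^{R\times S}$ invertible, $\nu_p,\mu_p>0$; $C_p=\min_{\|\eta\|_p=1}\|K_1\eta\|_p$, $r_p=\frac{C_p}{\mu_p}\big[1-2\frac{\nu_p}{C_p}\big(\sqrt{1+C_p/\nu_p}-1\big)\big]$,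 $\lambda_*=1+\sqrt{1+C_p/\nu_p}$, $R_*=C_p/(\mu_p(C_p+\nu_p\lambda_* ))$. Scattering data of $\eta$: $\phi=\sum_{j\ge1}K_j(\eta,\dots,\eta)$. Inverse Born operators: $\mathcal K_1=K_1^{-1}$ and, for $j\ge2$, $$\mathcal K_j(\phi_1,\dots,\phi_j)=-\sum_{m=1}^{j-1}\ \sum_{\substack{i_1+\dots+i_m=j\\ i_l\ge1}}\mathcal K_m\Big(K_{i_1}(\mathcal K_1\phi_1,\dots,\mathcal K_1\phi_{i_1}),\dots,K_{i_m}(\mathcal K_1\phi_{j-i_m+1},\dots,\mathcal K_1\phi_j)\Big);$$ the inverse Born series of $\phi$ is $\sum_{j\ge1}\mathcal K_j(\phi,\dots,\phi)$. By Theorem 6, for $\|\phi\|_p<r_p$ it converges to the unique $\eta$ with $\|\eta\|_p<R_*$ whose scattering data is $\phi$. *)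

theory Defs
  imports Complex_Main "HOL-Library.Extended_Real"
begin

(* Vectors in C^A are represented as total functions vanishing outside A. *)
definition supp_in :: "'x set \<Rightarrow> ('x \<Rightarrow> 'b::zero) set" where
  "supp_in A = {f. \<forall>x. x \<notin> A \<longrightarrow> f x = 0}"

definition lpnorm :: "'x set \<Rightarrow> ereal \<Rightarrow> ('x \<Rightarrow> 'b::real_normed_vector) \<Rightarrow> real" where
  "lpnorm A p f =
     (if p = \<infinity> then (if A = {} then 0 else Max ((\<lambda>x. norm (f x)) ` A))
      else (\<Sum>x\<in>A. norm (f x) powr real_of_ereal p) powr (1 / real_of_ereal p))"

(* gchain G V x [eta_1,...,eta_j] y =
   G^{x;V} D_{eta_1} G^{V;V} D_{eta_2} ... G^{V;V} D_{eta_j} G^{V;y} *)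
primrec gchain :: "('a \<Rightarrow> 'a \<Rightarrow> complex) \<Rightarrow> 'a set \<Rightarrow> 'a \<Rightarrow> ('a \<Rightarrow> complex) list \<Rightarrow> 'a \<Rightarrow> complex" where
  "gchain G V x [] y = G x y"
| "gchain G V x (e # es) y = (\<Sum>v\<in>V. G x v * e v * gchain G V v es y)"

definition Kop :: "('a \<Rightarrow> 'a \<Rightarrow> complex) \<Rightarrow> real \<Rightarrow> 'a set \<Rightarrow> 'a set \<Rightarrow> 'a set
      \<Rightarrow> ('a \<Rightarrow> complex) list \<Rightarrow> ('a \<times> 'a \<Rightarrow> complex)" where
  "Kop G a V R S etas = (\<lambda>(r, s). if r \<in> R \<and> s \<in> S then
       (-1) ^ (length etas + 1) * complex_of_real a ^ length etas * gchain G V r etas s else 0)"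

definition K1inv :: "('a \<Rightarrow> 'a \<Rightarrow> complex) \<Rightarrow> real \<Rightarrow> 'a set \<Rightarrow> 'a set \<Rightarrow> 'a set
      \<Rightarrow> ('a \<times> 'a \<Rightarrow> complex) \<Rightarrow> ('a \<Rightarrow> complex)" where
  "K1inv G a V R S phi = (THE eta. eta \<in> supp_in V \<and> Kop G a V R S [eta] = phi)"

primrec chunks :: "nat list \<Rightarrow> 'b list \<Rightarrow> 'b list list" where
  "chunks [] xs = []"
| "chunks (i # is) xs = take i xs # chunks is (drop i xs)"

lemma length_chunks [simp]: "length (chunks c xs) = length c"
  by (induction c arbitrary: xs) auto

definition comps :: "nat \<Rightarrow> nat \<Rightarrow> nat list set" where
  "comps m j = {c. length c = m \<and> sum_list c = j \<and> (\<forall>i\<in>set c. 1 \<le> i)}"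

function IB :: "('a \<Rightarrow> 'a \<Rightarrow> complex) \<Rightarrow> real \<Rightarrow> 'a set \<Rightarrow> 'a set \<Rightarrow> 'a set
      \<Rightarrow> ('a \<times> 'a \<Rightarrow> complex) list \<Rightarrow> ('a \<Rightarrow> complex)" where
  "IB G a V R S phis =
     (if length phis = 0 then (\<lambda>_. 0)
      else if length phis = 1 then K1inv G a V R S (hd phis)
      else (\<lambda>v. - (\<Sum>m\<in>{1..<length phis}. \<Sum>c\<in>comps m (length phis).
               IB G a V R S (map (\<lambda>ch. Kop G a V R S (map (K1inv G a V R S) ch)) (chunks c phis)) v)))"
  by pat_completeness auto
termination
  by (relation "measure (\<lambda>(G, a, V, R, S, phis). length phis)") (auto simp: comps_def)

definition psi :: "('a \<Rightarrow> 'a \<Rightarrow> complex) \<Rightarrow> real \<Rightarrow> 'a set \<Rightarrow> 'a set \<Rightarrow> 'a set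
      \<Rightarrow> ('a \<times> 'a \<Rightarrow> complex) \<Rightarrow> ('a \<Rightarrow> complex)" where
  "psi G a V R S phi = (\<lambda>v. \<Sum>m. IB G a V R S (replicate (Suc m) phi) v)"

definition nu_p :: "('a \<Rightarrow> 'a \<Rightarrow> complex) \<Rightarrow> real \<Rightarrow> 'a set \<Rightarrow> 'a set \<Rightarrow> 'a set \<Rightarrow> ereal \<Rightarrow> ereal \<Rightarrow> real" where
  "nu_p G a V R S p q = a * lpnorm R p (\<lambda>r. lpnorm V q (\<lambda>v. G r v))
                          * lpnorm S p (\<lambda>s. lpnorm V q (\<lambda>v. G v s))"

definition mu_p :: "('a \<Rightarrow> 'a \<Rightarrow> complex) \<Rightarrow> real \<Rightarrow> 'a set \<Rightarrow> ereal \<Rightarrow> real" where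
  "mu_p G a V q = a * Max ((\<lambda>v. lpnorm V q (\<lambda>w. G v w)) ` V)"

definition C_p :: "('a \<Rightarrow> 'a \<Rightarrow> complex) \<Rightarrow> real \<Rightarrow> 'a set \<Rightarrow> 'a set \<Rightarrow> 'a set \<Rightarrow> ereal \<Rightarrow> real" where
  "C_p G a V R S p = Inf {lpnorm (R \<times> S) p (Kop G a V R S [eta]) | eta.
                            eta \<in> supp_in V \<and> lpnorm V p eta = 1}"

end

theory Submission
  imports Defs "HOL-Complex_Analysis.Complex_Analysis"
begin

text \<open>
  The scattering equation \<open>\<phi> = K\<^sub>1 \<eta> + G \<eta>\<close>, with \<open>G\<close> collecting the terms of order at least two, is the
  fixed point equation \<open>\<eta> = K\<^sub>1\<inverse> (\<phi> - G \<eta>)\<close>. With \<open>h t = C t - \<nu> \<mu> t\<^sup>2 / (1 - \<mu> t)\<close>, the right-hand side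
  maps the ball of radius \<open>\<rho>\<close> to itself when \<open>\<parallel>\<phi>\<parallel> \<le> h \<rho>\<close>, and contracts it when \<open>h' \<rho> > 0\<close>. The critical
  point of \<open>h\<close> is \<open>R\<^sub>*\<close> and its critical value is \<open>r\<^sub>p\<close>, so for \<open>\<parallel>\<phi>\<parallel> < r\<^sub>p\<close> there is a unique solution
  \<open>\<eta>(\<phi>)\<close> in the ball of radius \<open>R\<^sub>*\<close>; as a uniform limit of iterates, \<open>z \<mapsto> \<eta>(z \<phi>)\<close> is holomorphic.

  The recursion for the inverse Born operators says that \<open>\<Sum>\<^sub>m \<K>\<^sub>m (F \<xi>, \<dots>, F \<xi>) = \<xi>\<close> to every finite order in
  \<open>\<xi>\<close>, where \<open>F \<xi>\<close> is the scattering data. Taking \<open>\<xi> = \<eta>(z \<phi>) = O(z)\<close> identifies the Taylor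
  coefficients of \<open>\<eta>(z \<phi>)\<close> as \<open>\<K>\<^sub>m (\<phi>, \<dots>, \<phi>)\<close>, without any bound on the growth of \<open>\<K>\<^sub>m\<close>. The one-variable Cauchy
  estimate then bounds them by \<open>M (\<parallel>\<phi>\<parallel> / (\<tau> r\<^sub>p))\<^sup>m\<close>, and the tail is a geometric series; the factor
  \<open>(1 / (1 - \<tau>))\<^sup>n\<close>, which a Cauchy estimate in \<open>n\<close> variables would produce, is at least 1.
\<close>

section \<open>The norm on functions with finite domain\<close>

lemma lpnorm_ereal:
  "lpnorm A (ereal r) f = (\<Sum>x\<in>A. norm (f x) powr r) powr (1 / r)"
  by (simp add: lpnorm_def)

lemma lpnorm_infinity: "A \<noteq> {} \<Longrightarrow> lpnorm A \<infinity> f = Max ((\<lambda>x. norm (f x)) ` A)"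
  by (simp add: lpnorm_def)

lemma ge_1_ereal_cases:
  assumes "1 \<le> (p::ereal)"
  obtains "p = \<infinity>" | r where "p = ereal r" "1 \<le> r"
  using assms by (cases p) auto

lemma lpnorm_nonneg:
  assumes "finite A" shows "0 \<le> lpnorm A p f"
  using assms by (auto simp: lpnorm_def Max_ge_iff)

lemma norm_le_lpnorm:
  assumes "finite A" "1 \<le> p" "x \<in> A"
  shows "norm (f x) \<le> lpnorm A p f"
  using assms(2)
proof (cases rule: ge_1_ereal_cases)
  case 1
  with assms show ?thesis by (auto simp: lpnorm_def)
next
  case (2 r)
  have "norm (f x) powr r \<le> (\<Sum>x\<in>A. norm (f x) powr r)"
    using assms by (intro member_le_sum) auto
  then have "(norm (f x) powr r) powr (1/r) \<le> (\<Sum>x\<in>A. norm (f x) powr r) powr (1/r)"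
    using 2 by (intro powr_mono2) auto
  then show ?thesis using 2 by (simp add: powr_powr lpnorm_ereal)
qed

lemma lpnorm_mono:
  assumes "finite A" "1 \<le> p" "\<And>x. x \<in> A \<Longrightarrow> norm (f x) \<le> norm (g x)"
  shows "lpnorm A p f \<le> lpnorm A p g"
  using assms(2)
proof (cases rule: ge_1_ereal_cases)
  case 1
  show ?thesis
  proof (cases "A = {}")
    case False
    have "norm (f x) \<le> Max ((\<lambda>x. norm (g x)) ` A)" if "x \<in> A" for x
      using assms that by (meson Max_ge dual_order.trans finite_imageI imageI)
    with False 1 assms(1) show ?thesis by (simp add: lpnorm_infinity)
  qed (simp add: lpnorm_def)
next
  case (2 r)
  with assms show ?thesis
    by (auto simp: lpnorm_ereal intro!: powr_mono2 sum_mono sum_nonneg)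
qed

lemma lpnorm_cong: "(\<And>x. x \<in> A \<Longrightarrow> f x = g x) \<Longrightarrow> lpnorm A p f = lpnorm A p g"
  by (auto simp: lpnorm_def intro!: arg_cong[where f=Max] image_cong arg_cong[where f="\<lambda>s. s powr _"] sum.cong)

lemma lpnorm_mult_left:
  fixes f :: "'x \<Rightarrow> 'b::real_normed_div_algebra"
  assumes "finite A" "1 \<le> p"
  shows "lpnorm A p (\<lambda>x. c * f x) = norm c * lpnorm A p f"
  using assms(2)
proof (cases rule: ge_1_ereal_cases)
  case 1
  show ?thesis
  proof (cases "A = {}")
    case False
    have "mono ((*) (norm c))" by (auto simp: mono_def intro: mult_left_mono)
    from mono_Max_commute[OF this, of "(\<lambda>x. norm (f x)) ` A"] False assms
    have "norm c * Max ((\<lambda>x. norm (f x)) ` A) = Max ((*) (norm c) ` (\<lambda>x. norm (f x)) ` A)" by simp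
    also have "\<dots> = Max ((\<lambda>x. norm (c * f x)) ` A)" by (simp add: image_image norm_mult)
    finally show ?thesis using 1 False by (simp add: lpnorm_infinity)
  qed (simp add: lpnorm_def 1)
next
  case (2 r)
  then show ?thesis
    by (simp add: lpnorm_ereal norm_mult powr_mult sum_nonneg powr_powr flip: sum_distrib_left)
qed

text \<open>For positive arguments this is \<open>powr_convex\<close>; when one argument is 0 it
  reduces to \<open>s powr r \<le> s\<close> for \<open>0 < s < 1\<close>.\<close>

lemma convex_powr_atLeast_0:
  fixes u v t :: real
  assumes "1 \<le> r" "0 \<le> u" "0 \<le> v" "0 < t" "t < 1"
  shows "(t * u + (1 - t) * v) powr r \<le> t * u powr r + (1 - t) * v powr r"
proof -
  have small: "s powr r \<le> s" if "0 < s" "s < 1" for s :: real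
    using powr_mono'[of 1 r s] that assms(1) by simp
  consider "u = 0" | "v = 0" | "u > 0" "v > 0" using assms by linarith
  then show ?thesis
  proof cases
    case 3
    then show ?thesis
      using convex_onD[OF powr_convex[OF assms(1)], of t v u] assms
      by (simp add: algebra_simps)
  qed (use assms small[of t] small[of "1-t"] in \<open>auto simp: powr_mult intro!: mult_right_mono\<close>)
qed

lemma lpnorm_eq_0_iff:
  fixes f :: "'x \<Rightarrow> 'b::real_normed_vector"
  assumes "finite A" "1 \<le> p"
  shows "lpnorm A p f = 0 \<longleftrightarrow> (\<forall>x\<in>A. f x = 0)"
proof
  assume "lpnorm A p f = 0"
  then show "\<forall>x\<in>A. f x = 0" using norm_le_lpnorm[OF assms, of _ f] by simp
next
  assume "\<forall>x\<in>A. f x = 0"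
  then have "lpnorm A p f = lpnorm A p (\<lambda>_. 0::'b)" by (intro lpnorm_cong) auto
  also have "\<dots> = 0" by (simp add: lpnorm_def image_constant_conv)
  finally show "lpnorm A p f = 0" .
qed

text \<open>Minkowski's inequality by normalization: with \<open>a\<close>, \<open>b\<close> the two
  norms, \<open>norm (f x) + norm (g x)\<close> is \<open>a + b\<close> times a convex combination
  of \<open>norm (f x) / a\<close> and \<open>norm (g x) / b\<close>. Convexity of the power applies
  pointwise, and summation leaves exactly \<open>(a + b) powr r\<close>. A vanishing norm is treated
  apart, since it forbids the division.\<close>

lemma lpnorm_triangle:
  assumes "finite A" "1 \<le> p"
  shows "lpnorm A p (\<lambda>x. f x + g x) \<le> lpnorm A p f + lpnorm A p g"
  using assms(2)
proof (cases rule: ge_1_ereal_cases)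
  case 1
  show ?thesis
  proof (cases "A = {}")
    case False
    have "norm (f x + g x) \<le> lpnorm A p f + lpnorm A p g" if "x \<in> A" for x
      using norm_le_lpnorm[OF assms that, of f] norm_le_lpnorm[OF assms that, of g] norm_triangle_ineq[of "f x" "g x"]
      by linarith
    then show ?thesis using False assms(1) 1 by (simp add: lpnorm_infinity)
  qed (simp add: lpnorm_def 1)
next
  case (2 r)
  define a where "a = lpnorm A p f"
  define b where "b = lpnorm A p g"
  have nn: "a \<ge> 0" "b \<ge> 0" using assms(1) by (auto simp: a_def b_def lpnorm_nonneg)
  consider "a = 0" | "b = 0" | "a > 0" "b > 0" using nn by linarith
  then show ?thesis
  proof cases
    case 3
    define t where "t = a / (a + b)"
    have t: "0 < t" "t < 1" "1 - t = b / (a + b)" using 3 by (auto simp: t_def field_simps)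
    have pw: "norm (f x + g x) powr r \<le> (a + b) powr r * (t * (norm (f x) powr r / a powr r) + (1 - t) * (norm (g x) powr r / b powr r))" for x
    proof -
      have "norm (f x) + norm (g x) = (a + b) * (t * (norm (f x) / a) + (1 - t) * (norm (g x) / b))"
      proof -
        have "(a + b) * (t * (norm (f x) / a) + (1 - t) * (norm (g x) / b))
          = ((a + b) * t) * (norm (f x) / a) + ((a + b) * (1 - t)) * (norm (g x) / b)" by (simp only: distrib_left mult.assoc)
        also have "(a + b) * t = a" using 3 by (simp add: t_def)
        also have "(a + b) * (1 - t) = b" using 3 by (simp add: t(3))
        finally show ?thesis using 3 by simp
      qed
      then have "norm (f x + g x) \<le> (a + b) * (t * (norm (f x) / a) + (1 - t) * (norm (g x) / b))"
        using norm_triangle_ineq[of "f x" "g x"] by simp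
      then have "norm (f x + g x) powr r \<le> ((a + b) * (t * (norm (f x) / a) + (1 - t) * (norm (g x) / b))) powr r"
        using 2 by (intro powr_mono2) auto
      also have "\<dots> = (a + b) powr r * (t * (norm (f x) / a) + (1 - t) * (norm (g x) / b)) powr r"
        by (rule powr_mult)
      also have "\<dots> \<le> (a + b) powr r * (t * (norm (f x) / a) powr r + (1 - t) * (norm (g x) / b) powr r)"
        using 3 t 2 by (intro mult_left_mono convex_powr_atLeast_0) auto
      finally show ?thesis using 3 by (simp add: powr_divide)
    qed
    have ar: "(\<Sum>x\<in>A. norm (f x) powr r) = a powr r" "(\<Sum>x\<in>A. norm (g x) powr r) = b powr r"
      using 2 by (auto simp: a_def b_def lpnorm_ereal powr_powr sum_nonneg)
    have "(\<Sum>x\<in>A. norm (f x + g x) powr r) \<le> (a + b) powr r * (t * ((\<Sum>x\<in>A. norm (f x) powr r) / a powr r) + (1 - t) * ((\<Sum>x\<in>A. norm (g x) powr r) / b powr r))"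
      by (rule order_trans[OF sum_mono[OF pw]]) (simp add: sum.distrib sum_distrib_left sum_divide_distrib distrib_left)
    also have "\<dots> = (a + b) powr r" using 3 by (simp add: ar)
    finally have "lpnorm A p (\<lambda>x. f x + g x) \<le> ((a + b) powr r) powr (1/r)"
      using 2 by (auto simp: lpnorm_ereal intro!: powr_mono2 sum_nonneg)
    then show ?thesis using 2 3 by (simp add: powr_powr a_def b_def)
  next
    case 1
    then have "\<forall>x\<in>A. f x = 0" unfolding a_def by (simp only: lpnorm_eq_0_iff[OF assms])
    then have "lpnorm A p (\<lambda>x. f x + g x) = lpnorm A p g" by (intro lpnorm_cong) auto
    then show ?thesis using nn by (simp add: a_def)
  next
    case 2
    then have "\<forall>x\<in>A. g x = 0" unfolding b_def by (simp only: lpnorm_eq_0_iff[OF assms])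
    then have "lpnorm A p (\<lambda>x. f x + g x) = lpnorm A p f" by (intro lpnorm_cong) auto
    then show ?thesis using nn by (simp add: b_def)
  qed
qed

lemma lpnorm_sum_le:
  fixes h :: "'i \<Rightarrow> 'x \<Rightarrow> 'b::real_normed_vector"
  assumes "finite A" "1 \<le> p"
  shows "finite I \<Longrightarrow> lpnorm A p (\<lambda>x. \<Sum>i\<in>I. h i x) \<le> (\<Sum>i\<in>I. lpnorm A p (h i))"
proof (induction I rule: finite_induct)
  case empty
  then show ?case using lpnorm_eq_0_iff[OF assms, of "\<lambda>_. 0::'b"] by simp
next
  case (insert i I)
  then show ?case using lpnorm_triangle[OF assms, of "h i" "\<lambda>x. \<Sum>i\<in>I. h i x"] by simp
qed

text \<open>A function is the sum of its point masses, each of norm at most the modulus of its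
  value. Through this bound, pointwise convergence on the finite domain becomes convergence in
  norm.\<close>

lemma lpnorm_le_l1:
  fixes f :: "'x \<Rightarrow> complex"
  assumes "finite A" "1 \<le> p"
  shows "lpnorm A p f \<le> (\<Sum>x\<in>A. norm (f x))"
proof -
  have delta: "lpnorm A p (\<lambda>y. if y = x then f x else 0) \<le> norm (f x)" if "x \<in> A" for x
    using assms(2)
  proof (cases rule: ge_1_ereal_cases)
    case 1
    moreover have "A \<noteq> {}" using that by auto
    ultimately show ?thesis using assms(1) by (auto simp: lpnorm_infinity)
  next
    case (2 r)
    have "(\<Sum>y\<in>A. norm (if y = x then f x else 0) powr r) = (\<Sum>y\<in>A. if y = x then norm (f x) powr r else 0)"
      by (intro sum.cong) auto
    then show ?thesis using 2 assms(1) that by (simp add: lpnorm_ereal powr_powr)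
  qed
  have "lpnorm A p f = lpnorm A p (\<lambda>y. \<Sum>x\<in>A. if y = x then f x else 0)"
    using assms(1) by (intro lpnorm_cong) simp
  also have "\<dots> \<le> (\<Sum>x\<in>A. lpnorm A p (\<lambda>y. if y = x then f x else 0))"
    by (intro lpnorm_sum_le assms)
  also have "\<dots> \<le> (\<Sum>x\<in>A. norm (f x))" by (intro sum_mono delta)
  finally show ?thesis .
qed

text \<open>At finite exponents both functions are normalized and Young's inequality is summed; an
  infinite exponent forces the other one to be 1, where the maximum can be pulled out of the
  sum.\<close>

lemma lpnorm_Holder:
  fixes f g :: "'x \<Rightarrow> complex"
  assumes "finite A" "1 \<le> p" "1 \<le> q" "inverse p + inverse q = 1"
  shows "(\<Sum>x\<in>A. norm (f x) * norm (g x)) \<le> lpnorm A q f * lpnorm A p g"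
proof -
  have l1inf: "(\<Sum>x\<in>A. norm (f x) * norm (g x)) \<le> lpnorm A 1 f * lpnorm A \<infinity> g" for f g :: "'x \<Rightarrow> complex"
  proof -
    have "(\<Sum>x\<in>A. norm (f x) * norm (g x)) \<le> (\<Sum>x\<in>A. norm (f x) * lpnorm A \<infinity> g)"
      using norm_le_lpnorm[OF assms(1), of \<infinity> _ g] by (intro sum_mono mult_left_mono) auto
    also have "\<dots> = lpnorm A 1 f * lpnorm A \<infinity> g"
      by (simp add: sum_distrib_right lpnorm_ereal one_ereal_def sum_nonneg)
    finally show ?thesis .
  qed
  consider "p = \<infinity>" | "q = \<infinity>" | r s where "p = ereal r" "q = ereal s" "1 \<le> r" "1 \<le> s"
    using assms(2,3) by (metis ge_1_ereal_cases)
  then show ?thesis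
  proof cases
    case 1
    then have "q = 1" using assms(3,4) by (cases q) (auto simp: one_ereal_def field_simps split: if_splits)
    then show ?thesis using l1inf 1 by simp
  next
    case 2
    then have "p = 1" using assms(2,4) by (cases p) (auto simp: one_ereal_def field_simps split: if_splits)
    then show ?thesis using l1inf[of g f] 2 by (simp add: mult.commute)
  next
    case (3 r s)
    then have rs: "1 / r + 1 / s = 1" using assms(4)
      by (simp add: one_ereal_def divide_inverse)
    then have "r > 1" "s > 1" using 3 by (auto simp: less_le field_simps)
    define a where "a = lpnorm A q f"
    define b where "b = lpnorm A p g"
    have nn: "a \<ge> 0" "b \<ge> 0" using assms(1) by (auto simp: a_def b_def lpnorm_nonneg)
    consider "a = 0 \<or> b = 0" | "a > 0" "b > 0" using nn by linarith
    then show ?thesis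
    proof cases
      case 1
      then have "\<forall>x\<in>A. f x = 0 \<or> g x = 0"
        using lpnorm_eq_0_iff[OF assms(1,2), of g] lpnorm_eq_0_iff[OF assms(1,3), of f] by (auto simp: a_def b_def)
      then have "(\<Sum>x\<in>A. norm (f x) * norm (g x)) = 0" by (intro sum.neutral) auto
      then show ?thesis using nn by (simp add: a_def b_def)
    next
      case 2
      have ar: "(\<Sum>x\<in>A. norm (f x) powr s) = a powr s" "(\<Sum>x\<in>A. norm (g x) powr r) = b powr r"
        using 3 by (auto simp: a_def b_def lpnorm_ereal powr_powr sum_nonneg)
      have "(\<Sum>x\<in>A. (norm (f x) / a) * (norm (g x) / b)) \<le> (\<Sum>x\<in>A. (norm (f x) / a) powr s / s + (norm (g x) / b) powr r / r)"
        using \<open>r > 1\<close> \<open>s > 1\<close> rs 2 by (intro sum_mono Youngs_inequality) auto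
      also have "\<dots> = (\<Sum>x\<in>A. norm (f x) powr s) / a powr s / s + (\<Sum>x\<in>A. norm (g x) powr r) / b powr r / r"
        using 2 by (simp add: sum.distrib powr_divide sum_divide_distrib)
      also have "\<dots> = 1" using 2 rs by (simp add: ar)
      finally have "(\<Sum>x\<in>A. norm (f x) * norm (g x)) / (a * b) \<le> 1"
        by (simp add: sum_divide_distrib)
      then show ?thesis using 2 by (simp add: a_def b_def divide_le_eq)
    qed
  qed
qed

text \<open>For a finite exponent the power sum over the rectangle factors. Applied to row norms
  over \<open>R\<close> and column norms over \<open>S\<close>, this yields the two factors of
  \<open>nu_p\<close>.\<close>

lemma lpnorm_prod_le:
  fixes f :: "'x \<Rightarrow> real" and g :: "'y \<Rightarrow> real"
  assumes "finite A" "finite B" "1 \<le> p"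
  shows "lpnorm (A \<times> B) p (\<lambda>(x, y). f x * g y) \<le> lpnorm A p f * lpnorm B p g"
  using assms(3)
proof (cases rule: ge_1_ereal_cases)
  case 1
  show ?thesis
  proof (cases "A \<times> B = {}")
    case False
    have "\<bar>f x * g y\<bar> \<le> lpnorm A \<infinity> f * lpnorm B \<infinity> g" if "x \<in> A" "y \<in> B" for x y
      unfolding abs_mult using norm_le_lpnorm[OF assms(1), of \<infinity> x f] norm_le_lpnorm[OF assms(2), of \<infinity> y g] that
      by (intro mult_mono) (auto intro: order_trans lpnorm_nonneg assms)
    with False show ?thesis using assms 1 by (auto simp: lpnorm_infinity[of "A \<times> B"])
  qed (auto simp: lpnorm_def 1)
next
  case (2 r)
  have "(\<Sum>z\<in>A \<times> B. norm (case z of (x, y) \<Rightarrow> f x * g y) powr r) = (\<Sum>x\<in>A. norm (f x) powr r) * (\<Sum>y\<in>B. norm (g y) powr r)"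
    by (simp add: sum_product sum.cartesian_product abs_mult powr_mult case_prod_beta)
  then show ?thesis using 2 by (simp add: lpnorm_ereal powr_mult sum_nonneg)
qed

section \<open>Multilinear functionals\<close>

text \<open>The analysis below uses of the p-norm only that it is a seminorm squeezed between the
  maximum and the sum of the moduli on \<open>A\<close>. These two bounds make it blind to values
  outside \<open>A\<close> and equivalent to pointwise size on \<open>A\<close>.\<close>

locale fun_norm =
  fixes A :: "'x set" and N :: "('x \<Rightarrow> complex) \<Rightarrow> real"
  assumes finite_dom: "finite A"
    and triangle: "N (\<lambda>x. f x + g x) \<le> N f + N g"
    and scale: "N (\<lambda>x. c * f x) = cmod c * N f"
    and component_le: "x \<in> A \<Longrightarrow> cmod (f x) \<le> N f"
    and le_l1: "N f \<le> (\<Sum>x\<in>A. cmod (f x))"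
begin

lemma zero [simp]: "N (\<lambda>_. 0) = 0"
  using scale[of 0 "\<lambda>_. 0"] by simp

lemma uminus: "N (\<lambda>x. - f x) = N f"
  using scale[of "-1" f] by simp

lemma nonneg [simp]: "0 \<le> N f"
  using triangle[of f "\<lambda>x. - f x"] by (simp add: uminus)

lemma triangle_diff: "N (\<lambda>x. f x - g x) \<le> N f + N g"
  using triangle[of f "\<lambda>x. - g x"] by (simp add: uminus)

lemma diff_commute: "N (\<lambda>x. f x - g x) = N (\<lambda>x. g x - f x)"
  using uminus[of "\<lambda>x. f x - g x"] by simp

lemma le_add_diff: "N f \<le> N g + N (\<lambda>x. f x - g x)"
  using triangle[of g "\<lambda>x. f x - g x"] by simp

lemma cong:
  assumes "\<And>x. x \<in> A \<Longrightarrow> f x = g x" shows "N f = N g"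
proof (rule antisym)
  show "N f \<le> N g" using le_add_diff[of f g] le_l1[of "\<lambda>x. f x - g x"] assms by simp
  show "N g \<le> N f" using le_add_diff[of g f] le_l1[of "\<lambda>x. g x - f x"] assms by simp
qed

lemma sum_le: "N (\<lambda>x. \<Sum>i\<in>I. h i x) \<le> (\<Sum>i\<in>I. N (h i))"
proof (induction I rule: infinite_finite_induct)
  case (insert i I)
  then show ?case using triangle[of "h i" "\<lambda>x. \<Sum>i\<in>I. h i x"] by simp
qed auto

text \<open>On a finite domain pointwise convergence makes the l1 distance tend to 0, and
  \<open>le_l1\<close> turns that distance into an error term for \<open>N\<close>.\<close>

lemma limit_le:
  assumes lim: "\<And>x. x \<in> A \<Longrightarrow> (\<lambda>n. F n x) \<longlonglongrightarrow> f x"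
    and bd: "\<And>n. N (F n) \<le> B"
  shows "N f \<le> B"
proof (rule LIMSEQ_le_const)
  have "(\<lambda>n. B + (\<Sum>x\<in>A. cmod (f x - F n x))) \<longlonglongrightarrow> B + (\<Sum>x\<in>A. cmod (f x - f x))"
    using lim by (intro tendsto_intros)
  then show "(\<lambda>n. B + (\<Sum>x\<in>A. cmod (f x - F n x))) \<longlonglongrightarrow> B" by simp
  have "N f \<le> B + (\<Sum>x\<in>A. cmod (f x - F n x))" for n
    using le_add_diff[of f "F n"] le_l1[of "\<lambda>x. f x - F n x"] bd[of n] by linarith
  then show "\<exists>n0. \<forall>n\<ge>n0. N f \<le> B + (\<Sum>x\<in>A. cmod (f x - F n x))" by blast
qed

lemma suminf_le:
  assumes "\<And>x. x \<in> A \<Longrightarrow> summable (\<lambda>j. F j x)" "\<And>j. N (F j) \<le> b j" "summable b"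
  shows "N (\<lambda>x. \<Sum>j. F j x) \<le> suminf b"
proof (rule limit_le)
  show "(\<lambda>n. \<Sum>j<n. F j x) \<longlonglongrightarrow> (\<Sum>j. F j x)" if "x \<in> A" for x
    using assms(1)[OF that] by (rule summable_LIMSEQ)
  show "N (\<lambda>x. \<Sum>j<n. F j x) \<le> suminf b" for n
    using sum_le[of F "{..<n}"] sum_mono[of "{..<n}" "\<lambda>j. N (F j)" b] assms(2)
      sum_le_suminf[OF assms(3), of "{..<n}"] by (meson assms(2) finite_lessThan nonneg order_trans)
qed

end

lemma supp_in_zero [simp]: "(\<lambda>_. 0) \<in> supp_in A"
  and supp_in_add: "f \<in> supp_in A \<Longrightarrow> g \<in> supp_in A \<Longrightarrow> (\<lambda>x. f x + g x :: complex) \<in> supp_in A"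
  and supp_in_diff: "f \<in> supp_in A \<Longrightarrow> g \<in> supp_in A \<Longrightarrow> (\<lambda>x. f x - g x :: complex) \<in> supp_in A"
  and supp_in_scale: "f \<in> supp_in A \<Longrightarrow> (\<lambda>x. c * f x :: complex) \<in> supp_in A"
  by (auto simp: supp_in_def)

lemma supp_in_sum: "(\<And>i. i \<in> I \<Longrightarrow> h i \<in> supp_in A) \<Longrightarrow> (\<lambda>x. \<Sum>i\<in>I. h i x :: complex) \<in> supp_in A"
  by (auto simp: supp_in_def intro!: sum.neutral)

lemma (in fun_norm) eqI:
  assumes "f \<in> supp_in A" "g \<in> supp_in A" "N (\<lambda>x. f x - g x) \<le> 0"
  shows "f = g"
proof
  fix x
  have "cmod (f x - g x) \<le> 0" if "x \<in> A"
    using component_le[OF that, of "\<lambda>x. f x - g x"] assms(3) by linarith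
  then show "f x = g x" using assms(1,2) by (cases "x \<in> A") (auto simp: supp_in_def)
qed

section \<open>Expansion in unit functions and multilinear maps on lists\<close>

definition unit_fun :: "'x \<Rightarrow> 'x \<Rightarrow> complex" where
  "unit_fun x = (\<lambda>y. if y = x then 1 else 0)"

lemma unit_fun_supp_in: "x \<in> A \<Longrightarrow> unit_fun x \<in> supp_in A"
  by (auto simp: unit_fun_def supp_in_def)

lemma supp_in_expand:
  assumes "finite A" "f \<in> supp_in A"
  shows "f = (\<lambda>y. \<Sum>x\<in>A. f x * unit_fun x y)"
proof
  fix y
  have "(\<Sum>x\<in>A. f x * unit_fun x y) = (\<Sum>x\<in>A. if y = x then f x else 0)"
    by (intro sum.cong) (auto simp: unit_fun_def)
  then show "f y = (\<Sum>x\<in>A. f x * unit_fun x y)" using assms by (auto simp: supp_in_def)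
qed

text \<open>Writing the argument list as \<open>xs @ _ # ys\<close> exposes one slot, so a single
  functional on lists can carry all degrees at once. Lists of other lengths are unconstrained, and
  for \<open>n = 0\<close> the condition is empty.\<close>

definition mlin :: "'x set \<Rightarrow> nat \<Rightarrow> (('x \<Rightarrow> complex) list \<Rightarrow> complex) \<Rightarrow> bool" where
  "mlin A n T \<longleftrightarrow> (\<forall>xs ys f g a b. set xs \<subseteq> supp_in A \<longrightarrow> set ys \<subseteq> supp_in A \<longrightarrow>
     f \<in> supp_in A \<longrightarrow> g \<in> supp_in A \<longrightarrow> Suc (length xs + length ys) = n \<longrightarrow>
     T (xs @ (\<lambda>x. a * f x + b * g x) # ys) = a * T (xs @ f # ys) + b * T (xs @ g # ys))"

context
  fixes A :: "'x set" and n :: nat and T :: "('x \<Rightarrow> complex) list \<Rightarrow> complex"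
  assumes mlin: "mlin A n T"
begin

lemma mlin_lin:
  assumes "set xs \<subseteq> supp_in A" "set ys \<subseteq> supp_in A" "f \<in> supp_in A" "g \<in> supp_in A" "Suc (length xs + length ys) = n"
  shows "T (xs @ (\<lambda>x. a * f x + b * g x) # ys) = a * T (xs @ f # ys) + b * T (xs @ g # ys)"
  using mlin assms unfolding mlin_def by blast

lemma mlin_diff:
  assumes "set xs \<subseteq> supp_in A" "set ys \<subseteq> supp_in A" "f \<in> supp_in A" "g \<in> supp_in A" "Suc (length xs + length ys) = n"
  shows "T (xs @ (\<lambda>x. f x - g x) # ys) = T (xs @ f # ys) - T (xs @ g # ys)"
  using mlin_lin[OF assms, of 1 "-1"] by simp

lemma mlin_scale:
  assumes "set xs \<subseteq> supp_in A" "set ys \<subseteq> supp_in A" "f \<in> supp_in A" "Suc (length xs + length ys) = n"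
  shows "T (xs @ (\<lambda>x. a * f x) # ys) = a * T (xs @ f # ys)"
  using mlin_lin[OF assms(1-3) _ assms(4), of f a 0] assms(3) by simp

lemma mlin_sum:
  assumes "set xs \<subseteq> supp_in A" "set ys \<subseteq> supp_in A" "Suc (length xs + length ys) = n"
  shows "finite I \<Longrightarrow> (\<And>i. i \<in> I \<Longrightarrow> h i \<in> supp_in A) \<Longrightarrow>
    T (xs @ (\<lambda>x. \<Sum>i\<in>I. c i * h i x) # ys) = (\<Sum>i\<in>I. c i * T (xs @ h i # ys))"
proof (induction I rule: finite_induct)
  case empty
  then show ?case using mlin_scale[OF assms(1,2) _ assms(3), of "\<lambda>_. 0" 0] by simp
next
  case (insert i I)
  have "T (xs @ (\<lambda>x. c i * h i x + 1 * (\<Sum>i\<in>I. c i * h i x)) # ys)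
    = c i * T (xs @ h i # ys) + 1 * T (xs @ (\<lambda>x. \<Sum>i\<in>I. c i * h i x) # ys)"
    by (intro mlin_lin assms supp_in_sum supp_in_scale insert.prems) auto
  then show ?case using insert by simp
qed

text \<open>The slots are expanded from left to right; the prefix \<open>xs\<close> holds those
  already replaced by some \<open>h i\<close>, and is general so that the induction goes
  through.\<close>

lemma mlin_expand:
  assumes "finite I" "\<And>i. i \<in> I \<Longrightarrow> h i \<in> supp_in A"
  shows "set xs \<subseteq> supp_in A \<Longrightarrow> length xs + m = n \<Longrightarrow>
    T (xs @ replicate m (\<lambda>x. \<Sum>i\<in>I. h i x)) = (\<Sum>c | set c \<subseteq> I \<and> length c = m. T (xs @ map h c))"
proof (induction m arbitrary: xs)
  case 0
  have "{c. set c \<subseteq> I \<and> c = []} = {[]}" by auto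
  then show ?case by simp
next
  case (Suc m)
  define s where "s = (\<lambda>x. \<Sum>i\<in>I. h i x)"
  have s: "s \<in> supp_in A" unfolding s_def using assms by (intro supp_in_sum)
  have "{c. set c \<subseteq> I \<and> length c = Suc m} = (\<lambda>(i, c). i # c) ` (I \<times> {c. set c \<subseteq> I \<and> length c = m})"
    by (auto simp: length_Suc_conv image_iff)
  then have "(\<Sum>c | set c \<subseteq> I \<and> length c = Suc m. T (xs @ map h c))
    = (\<Sum>i\<in>I. \<Sum>c | set c \<subseteq> I \<and> length c = m. T ((xs @ [h i]) @ map h c))"
    by (simp add: sum.reindex inj_on_def sum.cartesian_product case_prod_beta)
  also have "\<dots> = (\<Sum>i\<in>I. T ((xs @ [h i]) @ replicate m s))"
    unfolding s_def using Suc assms by (intro sum.cong refl Suc.IH[symmetric]) auto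
  also have "\<dots> = T (xs @ (\<lambda>x. \<Sum>i\<in>I. 1 * h i x) # replicate m s)"
    using mlin_sum[of xs "replicate m s" I h "\<lambda>_. 1"] Suc.prems assms s by (auto simp: set_replicate_conv_if)
  finally show ?case by (simp add: s_def)
qed

lemma mlin_replicate_scale:
  assumes "f \<in> supp_in A"
  shows "set xs \<subseteq> supp_in A \<Longrightarrow> length xs + m = n \<Longrightarrow>
    T (xs @ replicate m (\<lambda>x. z * f x)) = z ^ m * T (xs @ replicate m f)"
proof (induction m arbitrary: xs)
  case (Suc m)
  have "T (xs @ (\<lambda>x. z * f x) # replicate m (\<lambda>x. z * f x)) = z * T (xs @ f # replicate m (\<lambda>x. z * f x))"
    using Suc.prems assms by (intro mlin_scale) (auto simp: set_replicate_conv_if intro: supp_in_scale)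
  also have "T (xs @ f # replicate m (\<lambda>x. z * f x)) = z ^ m * T (xs @ f # replicate m f)"
    using Suc.IH[of "xs @ [f]"] Suc.prems assms by simp
  finally show ?case by simp
qed simp

text \<open>\<open>f\<close> is exchanged for \<open>g\<close> one slot at a time from the left;
  \<open>U i\<close> has \<open>g\<close> in its first \<open>i\<close> slots, and the sum
  telescopes.\<close>

lemma mlin_replicate_diff:
  assumes "f \<in> supp_in A" "g \<in> supp_in A"
  shows "T (replicate n f) - T (replicate n g)
    = (\<Sum>i<n. T (replicate i g @ (\<lambda>x. f x - g x) # replicate (n - Suc i) f))"
proof -
  define U where "U i = T (replicate i g @ replicate (n - i) f)" for i
  have "T (replicate i g @ (\<lambda>x. f x - g x) # replicate (n - Suc i) f) = U i - U (Suc i)" if "i < n" for i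
  proof -
    have "T (replicate i g @ (\<lambda>x. f x - g x) # replicate (n - Suc i) f)
      = T (replicate i g @ f # replicate (n - Suc i) f) - T (replicate i g @ g # replicate (n - Suc i) f)"
      using that assms by (intro mlin_diff) (auto simp: set_replicate_conv_if)
    also have "f # replicate (n - Suc i) f = replicate (n - i) f"
      using that by (metis Suc_diff_Suc replicate_Suc)
    also have "replicate i g @ g # replicate (n - Suc i) f = replicate (Suc i) g @ replicate (n - Suc i) f"
      by (simp add: replicate_app_Cons_same)
    finally show ?thesis by (simp add: U_def)
  qed
  then have "(\<Sum>i<n. T (replicate i g @ (\<lambda>x. f x - g x) # replicate (n - Suc i) f)) = (\<Sum>i<n. U i - U (Suc i))"
    by (intro sum.cong) auto
  also have "\<dots> = U 0 - U n" by (rule sum_lessThan_telescope')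
  finally show ?thesis by (simp add: U_def)
qed

text \<open>Expanding the first free slot in unit functions makes its coordinates
  \<open>h z x\<close> scalar holomorphic factors and puts a constant unit function into the prefix,
  so induction on the number of free slots applies.\<close>

lemma mlin_holomorphic:
  assumes "finite A" and h: "\<And>z. z \<in> S \<Longrightarrow> h z \<in> supp_in A"
    and hol: "\<And>x. x \<in> A \<Longrightarrow> (\<lambda>z. h z x) holomorphic_on S"
  shows "set xs \<subseteq> supp_in A \<Longrightarrow> length xs + m = n \<Longrightarrow> (\<lambda>z. T (xs @ replicate m (h z))) holomorphic_on S"
proof (induction m arbitrary: xs)
  case (Suc m)
  have eq: "T (xs @ h z # replicate m (h z)) = (\<Sum>x\<in>A. h z x * T (xs @ unit_fun x # replicate m (h z)))" if "z \<in> S" for z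
  proof -
    have "T (xs @ h z # replicate m (h z)) = T (xs @ (\<lambda>y. \<Sum>x\<in>A. h z x * unit_fun x y) # replicate m (h z))"
      using supp_in_expand[OF assms(1) h[OF that]] by simp
    also have "\<dots> = (\<Sum>x\<in>A. h z x * T (xs @ unit_fun x # replicate m (h z)))"
      using Suc.prems h[OF that] by (intro mlin_sum assms) (auto simp: set_replicate_conv_if unit_fun_supp_in)
    finally show ?thesis .
  qed
  have "(\<lambda>z. \<Sum>x\<in>A. h z x * T ((xs @ [unit_fun x]) @ replicate m (h z))) holomorphic_on S"
    using Suc.prems by (intro holomorphic_intros hol Suc.IH) (auto simp: unit_fun_supp_in)
  then show ?case using eq by (simp cong: holomorphic_cong)
qed simp

end

text \<open>Finite dimension: fixing the first argument at each unit function lowers the degree, and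
  the coordinates of a general first argument are at most its norm. The constant may grow with the
  degree in any way.\<close>

lemma (in fun_norm) mlin_bounded:
  assumes "mlin A n T"
  shows "\<exists>K\<ge>0. \<forall>xs. length xs = n \<and> set xs \<subseteq> supp_in A \<longrightarrow> cmod (T xs) \<le> K * prod_list (map N xs)"
  using assms
proof (induction n arbitrary: T)
  case 0
  then show ?case by (intro exI[of _ "cmod (T [])"]) auto
next
  case (Suc n)
  have "mlin A n (\<lambda>xs. T (unit_fun x # xs))" if "x \<in> A" for x
    unfolding mlin_def
  proof (intro allI impI)
    fix xs ys :: "('x \<Rightarrow> complex) list" and f g :: "'x \<Rightarrow> complex" and a b
    assume "set xs \<subseteq> supp_in A" "set ys \<subseteq> supp_in A" "f \<in> supp_in A" "g \<in> supp_in A" "Suc (length xs + length ys) = n"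
    then show "T (unit_fun x # xs @ (\<lambda>x. a * f x + b * g x) # ys) = a * T (unit_fun x # xs @ f # ys) + b * T (unit_fun x # xs @ g # ys)"
      using mlin_lin[OF Suc.prems, of "unit_fun x # xs" ys f g a b] that by (simp add: unit_fun_supp_in)
  qed
  then have "\<forall>x\<in>A. \<exists>K\<ge>0. \<forall>xs. length xs = n \<and> set xs \<subseteq> supp_in A \<longrightarrow> cmod (T (unit_fun x # xs)) \<le> K * prod_list (map N xs)"
    using Suc.IH by blast
  then obtain K where K: "\<And>x. x \<in> A \<Longrightarrow> K x \<ge> 0"
    "\<And>x xs. x \<in> A \<Longrightarrow> length xs = n \<Longrightarrow> set xs \<subseteq> supp_in A \<Longrightarrow> cmod (T (unit_fun x # xs)) \<le> K x * prod_list (map N xs)"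
    by metis
  show ?case
  proof (intro exI conjI allI impI)
    show "(\<Sum>x\<in>A. K x) \<ge> 0" using K(1) by (intro sum_nonneg)
    fix xs :: "('x \<Rightarrow> complex) list"
    assume xs: "length xs = Suc n \<and> set xs \<subseteq> supp_in A"
    then obtain f ys where [simp]: "xs = f # ys" "length ys = n" by (auto simp: length_Suc_conv)
    have "T (f # ys) = T ([] @ (\<lambda>y. \<Sum>x\<in>A. f x * unit_fun x y) # ys)"
      using supp_in_expand[OF finite_dom, of f] xs by simp
    also have "\<dots> = (\<Sum>x\<in>A. f x * T ([] @ unit_fun x # ys))"
      using xs by (intro mlin_sum[OF Suc.prems] finite_dom unit_fun_supp_in) auto
    finally have "cmod (T (f # ys)) \<le> (\<Sum>x\<in>A. cmod (f x) * cmod (T (unit_fun x # ys)))"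
      by (simp add: norm_sum norm_mult order_trans[OF norm_sum])
    also have "\<dots> \<le> (\<Sum>x\<in>A. N f * (K x * prod_list (map N ys)))"
      using xs K by (intro sum_mono mult_mono component_le) auto
    also have "\<dots> = (\<Sum>x\<in>A. K x) * prod_list (map N (f # ys))"
      by (simp add: sum_distrib_left sum_distrib_right mult_ac)
    finally show "cmod (T xs) \<le> (\<Sum>x\<in>A. K x) * prod_list (map N xs)" by simp
  qed
qed

section \<open>Solving the scattering equation\<close>

text \<open>The derivative of the geometric series without its first term; it sums the Lipschitz
  constants of the forward operators of order at least two.\<close>

lemma sums_Suc_Suc_geometric:
  fixes x :: real
  assumes "\<bar>x\<bar> < 1"
  shows "(\<lambda>j. real (j + 2) * x ^ (j + 1)) sums (1 / (1 - x)\<^sup>2 - 1)"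
proof -
  have "(\<lambda>j. real (Suc j) * x ^ j) sums (1 / (1 - x)\<^sup>2)"
    using geometric_deriv_sums[of x] assms by simp
  then show ?thesis using sums_Suc_iff[of "\<lambda>j. real (Suc j) * x ^ j" "1 / (1 - x)\<^sup>2 - 1"] by simp
qed

text \<open>The forward problem stripped of the graph: multilinear operators with geometric bounds
  and an inverse \<open>J\<close> of the linear part \<open>K [_]\<close>. The constant
  \<open>C\<close> is tied to \<open>K\<close> through the bound \<open>1 / C\<close> on
  \<open>J\<close>.\<close>

locale born = X: fun_norm A NX + Y: fun_norm B NY
  for A :: "'v set" and NX and B :: "'y set" and NY +
  fixes K :: "('v \<Rightarrow> complex) list \<Rightarrow> 'y \<Rightarrow> complex"
    and J :: "('y \<Rightarrow> complex) \<Rightarrow> ('v \<Rightarrow> complex)"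
    and nu mu C :: real
  assumes nu_pos: "nu > 0" and mu_pos: "mu > 0" and C_pos: "C > 0"
    and K_mlin: "mlin A n (\<lambda>es. K es y)"
    and K_supp: "K es \<in> supp_in B"
    and K_bound: "es \<noteq> [] \<Longrightarrow> set es \<subseteq> supp_in A \<Longrightarrow>
      NY (K es) \<le> nu * mu ^ (length es - 1) * prod_list (map NX es)"
    and J_supp: "phi \<in> supp_in B \<Longrightarrow> J phi \<in> supp_in A"
    and K_J: "phi \<in> supp_in B \<Longrightarrow> K [J phi] = phi"
    and J_K: "eta \<in> supp_in A \<Longrightarrow> J (K [eta]) = eta"
    and J_bound: "phi \<in> supp_in B \<Longrightarrow> NX (J phi) \<le> NY phi / C"
begin

lemma K_lin:
  assumes "f \<in> supp_in A" "g \<in> supp_in A"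
  shows "K [\<lambda>x. a * f x + b * g x] = (\<lambda>y. a * K [f] y + b * K [g] y)"
  using mlin_lin[OF K_mlin, of "[]" "[]" f g 1 a b] assms by auto

lemma J_lin:
  assumes "f \<in> supp_in B" "g \<in> supp_in B"
  shows "J (\<lambda>x. a * f x + b * g x) = (\<lambda>y. a * J f y + b * J g y)"
proof -
  have "J (\<lambda>x. a * f x + b * g x) = J (K [\<lambda>y. a * J f y + b * J g y])"
    using assms by (simp add: K_lin J_supp K_J)
  also have "\<dots> = (\<lambda>y. a * J f y + b * J g y)"
    by (intro J_K supp_in_add supp_in_scale J_supp assms)
  finally show ?thesis .
qed

lemma J_diff:
  assumes "f \<in> supp_in B" "g \<in> supp_in B"
  shows "J (\<lambda>x. f x - g x) = (\<lambda>y. J f y - J g y)"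
  using J_lin[OF assms, of 1 "-1"] by simp

lemma J_mlin: "mlin B (Suc 0) (\<lambda>fs. J (hd fs) v)"
  unfolding mlin_def using J_lin by auto

lemma J_expand: "f \<in> supp_in B \<Longrightarrow> J f v = (\<Sum>x\<in>B. f x * J (unit_fun x) v)"
  using mlin_sum[OF J_mlin, of "[]" "[]" B unit_fun f v] supp_in_expand[OF Y.finite_dom, of f] Y.finite_dom
  by (auto simp: unit_fun_supp_in)

section \<open>The terms of order at least two\<close>

definition G :: "('v \<Rightarrow> complex) \<Rightarrow> 'y \<Rightarrow> complex" where
  "G eta = (\<lambda>y. \<Sum>j. K (replicate (j + 2) eta) y)"

lemma K_replicate_bound:
  assumes "f \<in> supp_in A" "NX f \<le> rho"
  shows "NY (K (replicate (Suc j) f)) \<le> nu * mu ^ j * rho ^ Suc j"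
proof -
  have "NY (K (replicate (Suc j) f)) \<le> nu * mu ^ j * NX f ^ Suc j"
    using K_bound[of "replicate (Suc j) f"] assms(1) by (auto simp: set_replicate_conv_if prod_list_replicate simp flip: replicate_Suc split: if_splits)
  also have "\<dots> \<le> nu * mu ^ j * rho ^ Suc j"
    using nu_pos mu_pos assms(2) by (intro mult_left_mono power_mono) auto
  finally show ?thesis .
qed

text \<open>Exchanging the arguments one slot at a time gives \<open>Suc j\<close> terms, each with
  one entry \<open>f - g\<close> and \<open>j\<close> entries of norm at most
  \<open>rho\<close>.\<close>

lemma K_replicate_diff_bound:
  assumes "f \<in> supp_in A" "g \<in> supp_in A" "NX f \<le> rho" "NX g \<le> rho"
  shows "NY (\<lambda>y. K (replicate (Suc j) f) y - K (replicate (Suc j) g) y)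
    \<le> nu * (real (Suc j) * (mu * rho) ^ j) * NX (\<lambda>x. f x - g x)"
proof -
  have rho: "rho \<ge> 0" using assms(3) X.nonneg order_trans by blast
  define U where "U i = replicate i g @ (\<lambda>x. f x - g x) # replicate (Suc j - Suc i) f" for i
  have "NY (K (U i)) \<le> nu * mu ^ j * rho ^ j * NX (\<lambda>x. f x - g x)" if "i < Suc j" for i
  proof -
    have "NY (K (U i)) \<le> nu * mu ^ (length (U i) - 1) * prod_list (map NX (U i))"
      using assms by (intro K_bound) (auto simp: U_def intro: supp_in_diff)
    also have "length (U i) - 1 = j" using that by (simp add: U_def)
    also have "prod_list (map NX (U i)) = NX g ^ i * NX f ^ (j - i) * NX (\<lambda>x. f x - g x)"
      by (simp add: U_def prod_list_replicate)
    also have "\<dots> \<le> rho ^ i * rho ^ (j - i) * NX (\<lambda>x. f x - g x)"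
      using assms rho by (intro mult_right_mono mult_mono power_mono) auto
    also have "rho ^ i * rho ^ (j - i) = rho ^ j" using that by (simp flip: power_add)
    finally show ?thesis using nu_pos mu_pos by (simp add: mult_ac)
  qed
  then have "(\<Sum>i<Suc j. NY (K (U i))) \<le> (\<Sum>i<Suc j. nu * mu ^ j * rho ^ j * NX (\<lambda>x. f x - g x))"
    by (intro sum_mono) auto
  moreover have "(\<lambda>y. K (replicate (Suc j) f) y - K (replicate (Suc j) g) y) = (\<lambda>y. \<Sum>i<Suc j. K (U i) y)"
    unfolding U_def by (intro ext mlin_replicate_diff[OF K_mlin] assms)
  ultimately show ?thesis using Y.sum_le[of "\<lambda>i. K (U i)" "{..<Suc j}"]
    by (simp add: power_mult_distrib mult_ac)
qed

lemma summable_G: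
  assumes "f \<in> supp_in A" "mu * NX f < 1"
  shows "summable (\<lambda>j. K (replicate (j + 2) f) y)"
proof (cases "y \<in> B")
  case True
  have x: "0 \<le> mu * NX f" using mu_pos by simp
  have "summable (\<lambda>j. nu * NX f * mu * NX f * (mu * NX f) ^ j)"
    using assms x by (intro summable_mult summable_geometric) auto
  then show ?thesis
  proof (rule summable_comparison_test'[where N = 0])
    fix j :: nat
    have "cmod (K (replicate (j + 2) f) y) \<le> NY (K (replicate (Suc (Suc j)) f))"
      using Y.component_le[OF True] by simp
    also have "\<dots> \<le> nu * mu ^ Suc j * NX f ^ Suc (Suc j)"
      using assms by (intro K_replicate_bound) auto
    finally show "norm (K (replicate (j + 2) f) y) \<le> nu * NX f * mu * NX f * (mu * NX f) ^ j"
      by (simp add: power_mult_distrib mult_ac)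
  qed
next
  case False
  then have "K es y = 0" for es using K_supp[of es] by (auto simp: supp_in_def)
  then show ?thesis by simp
qed

lemma G_supp: "G f \<in> supp_in B"
  using K_supp by (auto simp: G_def supp_in_def)

lemma G_bound:
  assumes "f \<in> supp_in A" "NX f \<le> rho" "mu * rho < 1"
  shows "NY (G f) \<le> nu * mu * rho\<^sup>2 / (1 - mu * rho)"
proof -
  have rho: "rho \<ge> 0" using assms(2) X.nonneg order_trans by blast
  have f: "mu * NX f < 1" using assms(2,3) mu_pos by (meson le_less_trans mult_left_mono less_imp_le)
  have "(\<lambda>j. nu * mu * rho\<^sup>2 * (mu * rho) ^ j) sums (nu * mu * rho\<^sup>2 * (1 / (1 - mu * rho)))"
    using assms rho mu_pos by (intro sums_mult geometric_sums) auto
  then have s: "(\<lambda>j. nu * mu * rho\<^sup>2 * (mu * rho) ^ j) sums (nu * mu * rho\<^sup>2 / (1 - mu * rho))" by simp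
  have "NY (G f) \<le> (\<Sum>j. nu * mu * rho\<^sup>2 * (mu * rho) ^ j)"
    unfolding G_def
  proof (rule Y.suminf_le)
    show "NY (K (replicate (j + 2) f)) \<le> nu * mu * rho\<^sup>2 * (mu * rho) ^ j" for j
      using K_replicate_bound[OF assms(1,2), of "Suc j"] by (simp add: power_mult_distrib power2_eq_square mult_ac)
  qed (use s summable_G[OF assms(1) f] in \<open>auto simp: sums_iff\<close>)
  with s show ?thesis by (simp add: sums_iff)
qed

text \<open>A Lipschitz constant of \<open>G\<close> on the ball of radius \<open>rho\<close>,
  divided by \<open>C\<close>. For the function \<open>h\<close> of the introduction it equals
  \<open>1 - h' rho / C\<close>, so \<open>kappa rho < 1\<close> says that the derivative of
  \<open>h\<close> is positive at \<open>rho\<close>.\<close>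

definition kappa :: "real \<Rightarrow> real" where
  "kappa rho = nu * (1 / (1 - mu * rho)\<^sup>2 - 1) / C"

lemma G_lipschitz:
  assumes "f \<in> supp_in A" "g \<in> supp_in A" "NX f \<le> rho" "NX g \<le> rho" "mu * rho < 1"
  shows "NY (\<lambda>y. G f y - G g y) \<le> C * kappa rho * NX (\<lambda>x. f x - g x)"
proof -
  have rho: "rho \<ge> 0" using assms(3) X.nonneg order_trans by blast
  have fg: "mu * NX f < 1" "mu * NX g < 1"
    using assms(3-5) mu_pos by (meson le_less_trans mult_left_mono less_imp_le)+
  have "\<bar>mu * rho\<bar> < 1" using rho mu_pos assms(5) by simp
  then have "(\<lambda>j. nu * (real (j + 2) * (mu * rho) ^ (j + 1)) * NX (\<lambda>x. f x - g x)) sums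
    (nu * (1 / (1 - mu * rho)\<^sup>2 - 1) * NX (\<lambda>x. f x - g x))"
    by (intro sums_mult sums_mult2 sums_Suc_Suc_geometric)
  then have s: "(\<lambda>j. nu * (real (j + 2) * (mu * rho) ^ (j + 1)) * NX (\<lambda>x. f x - g x)) sums
    (C * kappa rho * NX (\<lambda>x. f x - g x))" using C_pos by (simp add: kappa_def)
  have "(\<lambda>y. G f y - G g y) = (\<lambda>y. \<Sum>j. K (replicate (j + 2) f) y - K (replicate (j + 2) g) y)"
    unfolding G_def using assms fg by (intro ext suminf_diff summable_G)
  moreover have "NY (\<lambda>y. \<Sum>j. K (replicate (j + 2) f) y - K (replicate (j + 2) g) y)
    \<le> (\<Sum>j. nu * (real (j + 2) * (mu * rho) ^ (j + 1)) * NX (\<lambda>x. f x - g x))"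
  proof (rule Y.suminf_le)
    show "NY (\<lambda>y. K (replicate (j + 2) f) y - K (replicate (j + 2) g) y)
      \<le> nu * (real (j + 2) * (mu * rho) ^ (j + 1)) * NX (\<lambda>x. f x - g x)" for j
      using K_replicate_diff_bound[OF assms(1-4), of "Suc j"] by (simp add: mult_ac)
    show "summable (\<lambda>j. K (replicate (j + 2) f) y - K (replicate (j + 2) g) y)" for y
      using assms fg by (intro summable_diff summable_G)
  qed (use s in \<open>auto simp: sums_iff\<close>)
  ultimately show ?thesis using s by (simp add: sums_iff)
qed

text \<open>
  The critical point and the critical value of \<open>major\<close> below, which is \<open>h\<close> of the introduction; they equal
  \<open>R\<^sub>*\<close> and \<open>r\<^sub>p\<close>.
\<close>

definition Rs :: real where
  "Rs = (sqrt (1 + C / nu) - 1) / (mu * sqrt (1 + C / nu))"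

definition rs :: real where
  "rs = nu * (sqrt (1 + C / nu) - 1)\<^sup>2 / mu"

definition major :: "real \<Rightarrow> real" where
  "major rho = C * rho - nu * mu * rho\<^sup>2 / (1 - mu * rho)"

lemma sqrt_gt_1: "sqrt (1 + C / nu) > 1"
  using nu_pos C_pos by simp

lemma Rs_pos: "Rs > 0" and rs_pos: "rs > 0"
  using sqrt_gt_1 nu_pos mu_pos by (auto simp: Rs_def rs_def intro!: divide_pos_pos mult_pos_pos)

text \<open>The critical point equation \<open>h' Rs = 0\<close> reads
  \<open>(1 - mu * Rs)\<^sup>2 = 1 / (1 + C / nu)\<close>; this is its root with
  \<open>mu * Rs < 1\<close>.\<close>

lemma mu_Rs: "1 - mu * Rs = 1 / sqrt (1 + C / nu)"
  using sqrt_gt_1 mu_pos by (simp add: Rs_def field_simps)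

text \<open>\<open>kappa rho < 1\<close> amounts to
  \<open>(1 - mu * rho)\<^sup>2 > 1 / (1 + C / nu)\<close>, and by \<open>mu_Rs\<close> the square
  root of this threshold is \<open>1 - mu * Rs\<close>.\<close>

lemma less_Rs:
  assumes "0 \<le> rho" "rho < Rs"
  shows "mu * rho < 1" "0 \<le> kappa rho" "kappa rho < 1"
proof -
  let ?s = "sqrt (1 + C / nu)"
  have "mu * rho < mu * Rs" using assms mu_pos by simp
  then have 1: "1 - mu * rho > 1 / ?s" using mu_Rs by linarith
  moreover have "1 / ?s > 0" using sqrt_gt_1 by simp
  ultimately show "mu * rho < 1" by linarith
  have "1 - mu * rho \<le> 1" "0 < 1 - mu * rho" using assms(1) mu_pos \<open>mu * rho < 1\<close> by auto
  then have "(1 - mu * rho)\<^sup>2 \<le> 1" "(1 - mu * rho)\<^sup>2 > 0" by (auto simp: power_le_one)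
  then show "0 \<le> kappa rho" using nu_pos C_pos by (simp add: kappa_def)
  have "(1 / ?s)\<^sup>2 < (1 - mu * rho)\<^sup>2"
    using 1 \<open>1 / ?s > 0\<close> by (intro power_strict_mono) auto
  then have "1 / (1 - mu * rho)\<^sup>2 < ?s\<^sup>2"
    using sqrt_gt_1 \<open>(1 - mu * rho)\<^sup>2 > 0\<close> by (simp add: field_simps)
  also have "?s\<^sup>2 = 1 + C / nu" using nu_pos C_pos by simp
  finally have "1 / (1 - mu * rho)\<^sup>2 - 1 < C / nu" by linarith
  then have "nu * (1 / (1 - mu * rho)\<^sup>2 - 1) < nu * (C / nu)" using nu_pos by (rule mult_strict_left_mono)
  then show "kappa rho < 1" using nu_pos C_pos by (simp add: kappa_def)
qed

lemma major_Rs: "major Rs = rs"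
proof -
  \<comment> \<open>With the square root as the variable, \<open>C\<close>, \<open>Rs\<close> and
    \<open>1 - mu * Rs\<close> are all free of roots, and the claim becomes a rational identity in
    \<open>s\<close>.\<close>
  define s where "s = sqrt (1 + C / nu)"
  have s: "s > 1" using sqrt_gt_1 by (simp add: s_def)
  have "s\<^sup>2 = 1 + C / nu" using nu_pos C_pos by (simp add: s_def)
  then have C: "C = nu * (s\<^sup>2 - 1)" using nu_pos by simp
  have R: "Rs = (s - 1) / (mu * s)" by (simp add: Rs_def s_def)
  have "1 - mu * Rs = 1 / s" using mu_Rs by (simp add: s_def)
  then have "major Rs = nu * (s\<^sup>2 - 1) * ((s - 1) / (mu * s)) - nu * mu * ((s - 1) / (mu * s))\<^sup>2 * s"
    by (simp add: major_def) (simp only: R, subst C, simp)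
  also have "\<dots> = nu * (s - 1)\<^sup>2 / mu"
    using s mu_pos by (simp add: field_simps power2_eq_square)
  finally show ?thesis by (simp add: rs_def s_def)
qed

text \<open>\<open>major\<close> is continuous at \<open>Rs\<close> with value \<open>rs\<close>, so
  a radius slightly below \<open>Rs\<close> already reaches the level \<open>t\<close>. Staying
  strictly below \<open>Rs\<close> keeps \<open>kappa rho < 1\<close>.\<close>

lemma obtain_rho:
  assumes "t < rs"
  obtains rho where "0 \<le> rho" "rho < Rs" "t \<le> major rho"
proof -
  have "1 - mu * Rs \<noteq> 0" using mu_Rs sqrt_gt_1 by simp
  then have "isCont major Rs" unfolding major_def by (intro continuous_intros) auto
  then have "(major \<longlongrightarrow> rs) (at_left Rs)"
    using major_Rs by (simp add: isCont_def filterlim_at_split)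
  then have "eventually (\<lambda>x. t < major x) (at_left Rs)" by (rule order_tendstoD) (fact assms)
  moreover have "eventually (\<lambda>x. x \<in> {0<..<Rs}) (at_left Rs)" by (rule eventually_at_left_real[OF Rs_pos])
  ultimately have "eventually (\<lambda>x. t < major x \<and> x \<in> {0<..<Rs}) (at_left Rs)" by (rule eventually_conj)
  then obtain x where "t < major x \<and> x \<in> {0<..<Rs}"
    using eventually_happens trivial_limit_at_left_real by blast
  with that[of x] show thesis by auto
qed

section \<open>Fixed point iteration\<close>

definition step :: "('y \<Rightarrow> complex) \<Rightarrow> ('v \<Rightarrow> complex) \<Rightarrow> ('v \<Rightarrow> complex)" where
  "step phi eta = J (\<lambda>y. phi y - G eta y)"

lemma step_supp: "phi \<in> supp_in B \<Longrightarrow> step phi eta \<in> supp_in A"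
  unfolding step_def by (intro J_supp supp_in_diff G_supp)

lemma step_lipschitz:
  assumes phi: "phi \<in> supp_in B" and fg: "f \<in> supp_in A" "g \<in> supp_in A" "NX f \<le> rho" "NX g \<le> rho" and rho: "rho < Rs"
  shows "NX (\<lambda>x. step phi f x - step phi g x) \<le> kappa rho * NX (\<lambda>x. f x - g x)"
proof -
  have "rho \<ge> 0" using fg(3) X.nonneg order_trans by blast
  have "(\<lambda>x. step phi f x - step phi g x) = J (\<lambda>y. (phi y - G f y) - (phi y - G g y))"
    unfolding step_def by (intro J_diff[symmetric] supp_in_diff G_supp phi)
  also have "(\<lambda>y. (phi y - G f y) - (phi y - G g y)) = (\<lambda>y. G g y - G f y)" by auto
  finally have "NX (\<lambda>x. step phi f x - step phi g x) \<le> NY (\<lambda>y. G f y - G g y) / C"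
    using J_bound[OF supp_in_diff[OF G_supp G_supp], of g f] Y.diff_commute[of "G f" "G g"] by simp
  also have "\<dots> \<le> C * kappa rho * NX (\<lambda>x. f x - g x) / C"
    using C_pos less_Rs(1)[OF \<open>rho \<ge> 0\<close> rho] by (intro divide_right_mono G_lipschitz fg) auto
  finally show ?thesis using C_pos by simp
qed

text \<open>\<open>major\<close> is chosen so that this bound closes: adding the bound for
  \<open>G\<close> to \<open>major rho\<close> leaves \<open>C * rho\<close>, which the bound on
  \<open>J\<close> turns into \<open>rho\<close>.\<close>

lemma step_ball:
  assumes phi: "phi \<in> supp_in B" "NY phi \<le> major rho" and f: "f \<in> supp_in A" "NX f \<le> rho" and rho: "rho < Rs"
  shows "NX (step phi f) \<le> rho"
proof -
  have "rho \<ge> 0" using f(2) X.nonneg order_trans by blast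
  have "NX (step phi f) \<le> NY (\<lambda>y. phi y - G f y) / C"
    unfolding step_def by (intro J_bound supp_in_diff phi G_supp)
  also have "\<dots> \<le> (major rho + nu * mu * rho\<^sup>2 / (1 - mu * rho)) / C"
    using C_pos less_Rs(1)[OF \<open>rho \<ge> 0\<close> rho] phi(2)
    by (intro divide_right_mono order_trans[OF Y.triangle_diff] add_mono G_bound f) auto
  also have "\<dots> = rho" using C_pos by (simp add: major_def)
  finally show ?thesis .
qed

definition iter :: "('y \<Rightarrow> complex) \<Rightarrow> nat \<Rightarrow> ('v \<Rightarrow> complex)" where
  "iter phi k = (step phi ^^ k) (\<lambda>_. 0)"

lemma iter_0 [simp]: "iter phi 0 = (\<lambda>_. 0)" and iter_Suc: "iter phi (Suc k) = step phi (iter phi k)"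
  by (simp_all add: iter_def)

lemma iter_supp: "phi \<in> supp_in B \<Longrightarrow> iter phi k \<in> supp_in A"
  by (cases k) (auto simp: iter_Suc step_supp)

text \<open>The limit of the iterates is written as a telescoping series, so that the Weierstrass
  test applies to it as it stands.\<close>

definition sol :: "('y \<Rightarrow> complex) \<Rightarrow> 'v \<Rightarrow> complex" where
  "sol phi = (\<lambda>v. \<Sum>k. iter phi (Suc k) v - iter phi k v)"

lemma sol_supp: "phi \<in> supp_in B \<Longrightarrow> sol phi \<in> supp_in A"
  using iter_supp[of phi] by (auto simp: sol_def supp_in_def)

lemma summable_kappa:
  assumes "0 \<le> rho" "rho < Rs"
  shows "summable (\<lambda>k. rho * kappa rho ^ k)"
  using less_Rs[OF assms] by (intro summable_mult summable_geometric) auto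

context
  fixes phi rho
  assumes phi: "phi \<in> supp_in B" "NY phi \<le> major rho" and rho: "0 \<le> rho" "rho < Rs"
begin

lemma iter_ball: "NX (iter phi k) \<le> rho"
  by (induction k) (use rho phi in \<open>auto simp: iter_Suc intro!: step_ball iter_supp\<close>)

lemma iter_diff: "NX (\<lambda>v. iter phi (Suc k) v - iter phi k v) \<le> rho * kappa rho ^ k"
proof (induction k)
  case 0
  then show ?case using iter_ball[of "Suc 0"] by simp
next
  case (Suc k)
  have "NX (\<lambda>v. iter phi (Suc (Suc k)) v - iter phi (Suc k) v)
    \<le> kappa rho * NX (\<lambda>v. iter phi (Suc k) v - iter phi k v)"
    unfolding iter_Suc[of _ "Suc k"] iter_Suc[of _ k]
    using phi rho iter_ball[of "Suc k"] iter_ball[of k] iter_supp[OF phi(1), of "Suc k"] iter_supp[OF phi(1), of k]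
    by (intro step_lipschitz) (auto simp: iter_Suc)
  also have "\<dots> \<le> kappa rho * (rho * kappa rho ^ k)"
    using less_Rs[OF rho] by (intro mult_left_mono Suc.IH)
  finally show ?case by (simp add: mult_ac)
qed

lemma iter_component_diff: "cmod (iter phi (Suc k) v - iter phi k v) \<le> rho * kappa rho ^ k"
proof (cases "v \<in> A")
  case True
  then show ?thesis using X.component_le[OF True, of "\<lambda>v. iter phi (Suc k) v - iter phi k v"] iter_diff[of k] by simp
next
  case False
  then have "iter phi k v = 0" for k using iter_supp[OF phi(1), of k] by (auto simp: supp_in_def)
  then show ?thesis using rho less_Rs[OF rho] by simp
qed

lemma iter_tendsto: "(\<lambda>k. iter phi k v) \<longlonglongrightarrow> sol phi v"
proof -
  have "summable (\<lambda>k. iter phi (Suc k) v - iter phi k v)"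
    by (rule summable_comparison_test'[OF summable_kappa[OF rho], of 0]) (use iter_component_diff in auto)
  then have "(\<lambda>n. \<Sum>k<n. iter phi (Suc k) v - iter phi k v) \<longlonglongrightarrow> sol phi v"
    unfolding sol_def by (rule summable_LIMSEQ)
  then show ?thesis by (simp only: sum_lessThan_telescope[of "\<lambda>k. iter phi k v"]) simp
qed

lemma sol_ball: "NX (sol phi) \<le> rho"
  by (rule X.limit_le[OF iter_tendsto iter_ball])

text \<open>\<open>sol phi\<close> is compared with \<open>step phi (sol phi)\<close> through the
  iterates: both distances are controlled by \<open>d\<close>, which tends to 0 as a finite sum of
  coordinate distances.\<close>

lemma sol_fixed: "step phi (sol phi) = sol phi"
proof -
  define d where "d k = (\<Sum>v\<in>A. cmod (iter phi k v - sol phi v))" for k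
  have "d \<longlonglongrightarrow> (\<Sum>v\<in>A. cmod (sol phi v - sol phi v))"
    unfolding d_def by (intro tendsto_intros iter_tendsto)
  then have d0: "d \<longlonglongrightarrow> 0" by simp
  have le: "NX (\<lambda>v. iter phi k v - sol phi v) \<le> d k" for k
    unfolding d_def by (rule X.le_l1)
  have "NX (\<lambda>v. sol phi v - step phi (sol phi) v) \<le> d (Suc k) + kappa rho * d k" for k
  proof -
    have "NX (\<lambda>v. sol phi v - step phi (sol phi) v)
      \<le> NX (\<lambda>v. sol phi v - iter phi (Suc k) v) + NX (\<lambda>v. step phi (iter phi k) v - step phi (sol phi) v)"
      using X.triangle[of "\<lambda>v. sol phi v - iter phi (Suc k) v" "\<lambda>v. step phi (iter phi k) v - step phi (sol phi) v"]
      by (simp add: iter_Suc)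
    also have "NX (\<lambda>v. sol phi v - iter phi (Suc k) v) \<le> d (Suc k)"
      using le[of "Suc k"] X.diff_commute by metis
    also have "NX (\<lambda>v. step phi (iter phi k) v - step phi (sol phi) v) \<le> kappa rho * NX (\<lambda>v. iter phi k v - sol phi v)"
      using phi rho iter_ball sol_ball by (intro step_lipschitz iter_supp sol_supp)
    also have "\<dots> \<le> kappa rho * d k" using less_Rs[OF rho] by (intro mult_left_mono le)
    finally show ?thesis by simp
  qed
  moreover have "(\<lambda>k. d (Suc k) + kappa rho * d k) \<longlonglongrightarrow> 0 + kappa rho * 0"
    using d0 by (intro tendsto_intros LIMSEQ_Suc)
  ultimately have "NX (\<lambda>v. sol phi v - step phi (sol phi) v) \<le> 0 + kappa rho * 0"
    by (intro LIMSEQ_le_const) auto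
  then show ?thesis using X.eqI[OF sol_supp step_supp, of phi phi "sol phi"] phi(1) by simp
qed

text \<open>Comparison with the first iterate: \<open>G\<close> vanishes at 0, so
  \<open>step phi (\<lambda>_. 0)\<close> has norm at most \<open>NY phi / C\<close>, and the
  contraction absorbs the rest. The bound is linear in the norm of \<open>phi\<close>, which makes
  the solution for the data \<open>z * phi\<close> of order \<open>O(z)\<close>.\<close>

lemma sol_small: "NX (sol phi) \<le> NY phi / (C * (1 - kappa rho))"
proof -
  have "NX (\<lambda>v. sol phi v - step phi (\<lambda>_. 0) v) \<le> kappa rho * NX (\<lambda>v. sol phi v - 0)"
    using step_lipschitz[of phi "sol phi" "\<lambda>_. 0" rho] phi rho sol_ball
    by (simp add: sol_fixed sol_supp)
  moreover have "NX (step phi (\<lambda>_. 0)) \<le> NY phi / C"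
  proof -
    have "NY (G (\<lambda>_. 0)) \<le> 0" using G_bound[of "\<lambda>_. 0" 0] by simp
    then have "NY (\<lambda>y. phi y - G (\<lambda>_. 0) y) \<le> NY phi"
      using Y.triangle_diff[of phi "G (\<lambda>_. 0)"] by simp
    then have "NY (\<lambda>y. phi y - G (\<lambda>_. 0) y) / C \<le> NY phi / C" using C_pos by (simp add: divide_right_mono)
    moreover have "NX (step phi (\<lambda>_. 0)) \<le> NY (\<lambda>y. phi y - G (\<lambda>_. 0) y) / C"
      unfolding step_def by (intro J_bound supp_in_diff G_supp phi)
    ultimately show ?thesis by linarith
  qed
  ultimately have "NX (sol phi) \<le> NY phi / C + kappa rho * NX (sol phi)"
    using X.le_add_diff[of "sol phi" "step phi (\<lambda>_. 0)"] by simp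
  then have "NX (sol phi) * (1 - kappa rho) \<le> NY phi / C" by (simp add: algebra_simps)
  then show ?thesis using less_Rs[OF rho] C_pos by (simp add: field_simps)
qed

end

section \<open>The scattering equation and uniqueness of its solution\<close>

lemma K1_add_G_sums:
  assumes "f \<in> supp_in A" "mu * NX f < 1"
  shows "(\<lambda>j. K (replicate (Suc j) f) y) sums (K [f] y + G f y)"
proof -
  have "(\<lambda>j. K (replicate (Suc (Suc j)) f) y) sums G f y"
    using summable_G[OF assms, of y] by (simp add: G_def summable_sums)
  from sums_Suc[OF this] show ?thesis by (simp add: add.commute)
qed

lemma step_fixed_iff:
  assumes "phi \<in> supp_in B" "f \<in> supp_in A"
  shows "step phi f = f \<longleftrightarrow> (\<forall>y. K [f] y + G f y = phi y)"
proof
  assume "step phi f = f"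
  then have "K [f] = (\<lambda>y. phi y - G f y)" unfolding step_def
    by (metis K_J supp_in_diff G_supp assms(1))
  then show "\<forall>y. K [f] y + G f y = phi y" by simp
next
  assume *: "\<forall>y. K [f] y + G f y = phi y"
  have "(\<lambda>y. phi y - G f y) = K [f]"
  proof
    show "phi y - G f y = K [f] y" for y using *[rule_format, of y] by (metis add_diff_cancel_right')
  qed
  then show "step phi f = f" unfolding step_def using J_K[OF assms(2)] by simp
qed

text \<open>The larger of the two norms is itself a radius below \<open>Rs\<close>, so
  \<open>step phi\<close> contracts strictly on a ball containing both fixed points.\<close>

lemma step_fixed_unique:
  assumes "phi \<in> supp_in B" "f \<in> supp_in A" "g \<in> supp_in A" "NX f < Rs" "NX g < Rs"
    "step phi f = f" "step phi g = g"
  shows "f = g"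
proof -
  define rho where "rho = max (NX f) (NX g)"
  have rho: "0 \<le> rho" "rho < Rs" using assms by (auto simp: rho_def le_max_iff_disj)
  have "NX (\<lambda>x. f x - g x) \<le> kappa rho * NX (\<lambda>x. f x - g x)"
    using step_lipschitz[of phi f g rho] assms rho by (simp add: rho_def)
  then have "(1 - kappa rho) * NX (\<lambda>x. f x - g x) \<le> 0" by (simp add: algebra_simps)
  then have "NX (\<lambda>x. f x - g x) \<le> 0" using less_Rs[OF rho] by (simp add: mult_le_0_iff)
  then show ?thesis by (intro X.eqI assms)
qed

section \<open>Holomorphic dependence on the data\<close>

lemma G_holomorphic:
  assumes S: "open S" and h: "\<And>z. z \<in> S \<Longrightarrow> h z \<in> supp_in A" "\<And>z. z \<in> S \<Longrightarrow> NX (h z) \<le> rho"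
    and rho: "0 \<le> rho" "mu * rho < 1"
    and hol: "\<And>v. (\<lambda>z. h z v) holomorphic_on S"
  shows "(\<lambda>z. G (h z) y) holomorphic_on S"
proof (cases "y \<in> B")
  case True
  \<comment> \<open>On the ball of radius \<open>rho\<close> the terms have a geometric majorant
    independent of \<open>z\<close>, so holomorphy passes from the partial sums to the
    series.\<close>
  have ul: "uniform_limit S (\<lambda>n z. \<Sum>j<n. K (replicate (j + 2) (h z)) y) (\<lambda>z. G (h z) y) sequentially"
    unfolding G_def
  proof (rule Weierstrass_m_test)
    show "summable (\<lambda>j. nu * mu * rho\<^sup>2 * (mu * rho) ^ j)"
      using rho mu_pos by (intro summable_mult summable_geometric) auto
    fix j z assume "z \<in> S"
    have "cmod (K (replicate (j + 2) (h z)) y) \<le> NY (K (replicate (Suc (Suc j)) (h z)))"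
      using Y.component_le[OF True] by simp
    also have "\<dots> \<le> nu * mu ^ Suc j * rho ^ Suc (Suc j)"
      using h \<open>z \<in> S\<close> by (intro K_replicate_bound) auto
    finally show "norm (K (replicate (j + 2) (h z)) y) \<le> nu * mu * rho\<^sup>2 * (mu * rho) ^ j"
      by (simp add: power_mult_distrib power2_eq_square mult_ac)
  qed
  show ?thesis
  proof (rule holomorphic_uniform_sequence[OF S])
    show "(\<lambda>z. \<Sum>j<n. K (replicate (j + 2) (h z)) y) holomorphic_on S" for n
    proof (rule holomorphic_on_sum)
      have "(\<lambda>z. K ([] @ replicate (j + 2) (h z)) y) holomorphic_on S" for j
        by (rule mlin_holomorphic[OF K_mlin X.finite_dom h(1) hol]) auto
      then show "(\<lambda>z. K (replicate (j + 2) (h z)) y) holomorphic_on S" for j by simp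
    qed
    fix x assume "x \<in> S"
    then obtain d where "d > 0" "cball x d \<subseteq> S" using S open_contains_cball by blast
    then show "\<exists>d>0. cball x d \<subseteq> S \<and> uniform_limit (cball x d)
        (\<lambda>n z. \<Sum>j<n. K (replicate (j + 2) (h z)) y) (\<lambda>z. G (h z) y) sequentially"
      using uniform_limit_on_subset[OF ul] by blast
  qed
next
  case False
  then have "G f y = 0" for f using G_supp[of f] by (auto simp: supp_in_def)
  then show ?thesis by simp
qed

text \<open>Each iterate is holomorphic by induction, \<open>J\<close> being a finite linear
  combination of coordinates. The increments are at most \<open>rho * kappa rho ^ k\<close>
  uniformly in \<open>z\<close>, so the limit is holomorphic as well.\<close>

lemma sol_holomorphic:
  assumes S: "open S" and phi: "phi \<in> supp_in B" and rho: "0 \<le> rho" "rho < Rs"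
    and le: "\<And>z. z \<in> S \<Longrightarrow> cmod z * NY phi \<le> major rho"
  shows "(\<lambda>z. sol (\<lambda>y. z * phi y) v) holomorphic_on S"
proof -
  have zphi: "(\<lambda>y. z * phi y) \<in> supp_in B" for z using phi by (rule supp_in_scale)
  have le': "NY (\<lambda>y. z * phi y) \<le> major rho" if "z \<in> S" for z using le[OF that] by (simp add: Y.scale)
  have iter_hol: "(\<lambda>z. iter (\<lambda>y. z * phi y) k v) holomorphic_on S" for k v
  proof (induction k arbitrary: v)
    case (Suc k)
    have "(\<lambda>z. G (iter (\<lambda>y. z * phi y) k) y) holomorphic_on S" for y
      by (rule G_holomorphic[OF S _ _ rho(1) less_Rs(1)[OF rho] Suc.IH])
         (use iter_supp[OF zphi] iter_ball[OF zphi le' rho] in auto)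
    then have "(\<lambda>z. \<Sum>y\<in>B. (z * phi y - G (iter (\<lambda>y. z * phi y) k) y) * J (unit_fun y) v) holomorphic_on S"
      by (intro holomorphic_intros)
    moreover have "iter (\<lambda>y. z * phi y) (Suc k) v
      = (\<Sum>y\<in>B. (z * phi y - G (iter (\<lambda>y. z * phi y) k) y) * J (unit_fun y) v)" for z
      unfolding iter_Suc step_def by (intro J_expand supp_in_diff zphi G_supp)
    ultimately show ?case by simp
  qed simp
  have ul: "uniform_limit S (\<lambda>n z. \<Sum>k<n. iter (\<lambda>y. z * phi y) (Suc k) v - iter (\<lambda>y. z * phi y) k v)
      (\<lambda>z. sol (\<lambda>y. z * phi y) v) sequentially"
    unfolding sol_def
    by (rule Weierstrass_m_test[OF _ summable_kappa[OF rho]])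
       (use iter_component_diff[OF zphi le' rho] S in \<open>auto\<close>)
  show ?thesis
  proof (rule holomorphic_uniform_sequence[OF S])
    show "(\<lambda>z. \<Sum>k<n. iter (\<lambda>y. z * phi y) (Suc k) v - iter (\<lambda>y. z * phi y) k v) holomorphic_on S" for n
      by (intro holomorphic_intros iter_hol)
    fix x assume "x \<in> S"
    then obtain d where "d > 0" "cball x d \<subseteq> S" using S open_contains_cball by blast
    then show "\<exists>d>0. cball x d \<subseteq> S \<and> uniform_limit (cball x d)
        (\<lambda>n z. \<Sum>k<n. iter (\<lambda>y. z * phi y) (Suc k) v - iter (\<lambda>y. z * phi y) k v) (\<lambda>z. sol (\<lambda>y. z * phi y) v) sequentially"
      using uniform_limit_on_subset[OF ul] by blast
  qed
qed

end

section \<open>Identifying the Taylor coefficients\<close>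

text \<open>The difference of \<open>f\<close> and the polynomial is at most
  \<open>D * t ^ Suc n\<close> on the circle of small radius \<open>t\<close>, so Cauchy's
  inequality bounds its \<open>n\<close>-th derivative at 0 by \<open>fact n * D * t\<close>, and
  \<open>t\<close> tends to 0.\<close>

lemma deriv_eq_coeff_of_approx:
  fixes f :: "complex \<Rightarrow> complex"
  assumes f: "f holomorphic_on ball 0 r" "r > 0" and delta: "delta > 0" and n: "1 \<le> n"
    and approx: "\<And>z. cmod z \<le> delta \<Longrightarrow> cmod ((\<Sum>i=1..n. c i * z ^ i) - f z) \<le> D * cmod z ^ Suc n"
  shows "(deriv ^^ n) f 0 / fact n = c n"
proof -
  define P where "P = (\<lambda>z. \<Sum>i=1..n. c i * z ^ i)"
  have P_hol: "P holomorphic_on S" for S unfolding P_def by (intro holomorphic_intros)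
  have "P has_fps_expansion (\<Sum>i=1..n. fps_const (c i) * fps_X ^ i)"
    unfolding P_def by (intro fps_expansion_intros)
  from fps_nth_fps_expansion[OF this, of n]
  have "(deriv ^^ n) P 0 / fact n = (\<Sum>i=1..n. fps_nth (fps_const (c i) * fps_X ^ i) n)"
    by (simp add: fps_sum_nth)
  also have "\<dots> = (\<Sum>i=1..n. if i = n then c i else 0)"
    by (intro sum.cong) auto
  finally have "(deriv ^^ n) P 0 / fact n = (\<Sum>i=1..n. if i = n then c i else 0)" .
  then have dP: "(deriv ^^ n) P 0 / fact n = c n" using n by simp
  define d where "d = (\<lambda>z. P z - f z)"
  define L where "L = (deriv ^^ n) d 0"
  have d_hol: "d holomorphic_on ball 0 r" unfolding d_def by (intro holomorphic_intros P_hol f)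
  have "cmod L \<le> fact n * D * t" if "0 < t" "t < min r delta" for t
  proof -
    have "cmod ((deriv ^^ n) d 0) \<le> fact n * (D * t ^ Suc n) / t ^ n"
    proof (rule Cauchy_inequality)
      show "d holomorphic_on ball 0 t" "continuous_on (cball 0 t) d"
        using that by (auto intro!: holomorphic_on_imp_continuous_on holomorphic_on_subset[OF d_hol])
      show "cmod (d x) \<le> D * t ^ Suc n" if "cmod (0 - x) = t" for x
        using approx[of x] that \<open>t < min r delta\<close> by (simp add: d_def P_def)
    qed (fact that)
    then show ?thesis using that by (simp add: L_def mult_ac)
  qed
  then have "eventually (\<lambda>t. cmod L \<le> fact n * D * t) (at_right 0)"
    using f(2) delta unfolding eventually_at_right_field by (intro exI[of _ "min r delta"]) auto
  moreover have "((\<lambda>t. fact n * D * t) \<longlongrightarrow> fact n * D * 0) (at_right (0::real))"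
    by (intro tendsto_intros)
  ultimately have "cmod L \<le> fact n * D * 0"
    by (intro tendsto_lowerbound[where F = "at_right (0::real)"]) auto
  then have "(deriv ^^ n) d 0 = 0" by (simp add: L_def)
  moreover have "(deriv ^^ n) d 0 = (deriv ^^ n) P 0 - (deriv ^^ n) f 0"
    unfolding d_def by (rule higher_deriv_diff[OF P_hol f(1)]) (use f(2) in auto)
  ultimately show ?thesis using dP by simp
qed

lemma (in fun_norm) mlin_replicate_diff_bound:
  assumes mlin: "mlin A m T" and K: "K \<ge> 0"
    "\<And>xs. length xs = m \<Longrightarrow> set xs \<subseteq> supp_in A \<Longrightarrow> cmod (T xs) \<le> K * prod_list (map N xs)"
    and fg: "f \<in> supp_in A" "g \<in> supp_in A" "N f \<le> R" "N g \<le> R"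
  shows "cmod (T (replicate m f) - T (replicate m g)) \<le> real m * K * R ^ (m - 1) * N (\<lambda>x. f x - g x)"
proof -
  have R: "R \<ge> 0" using fg(3) nonneg order_trans by blast
  have "cmod (T (replicate i g @ (\<lambda>x. f x - g x) # replicate (m - Suc i) f)) \<le> K * R ^ (m - 1) * N (\<lambda>x. f x - g x)"
    if "i < m" for i
  proof -
    have "cmod (T (replicate i g @ (\<lambda>x. f x - g x) # replicate (m - Suc i) f))
      \<le> K * prod_list (map N (replicate i g @ (\<lambda>x. f x - g x) # replicate (m - Suc i) f))"
      using that fg by (intro K) (auto simp: set_replicate_conv_if intro: supp_in_diff)
    also have "prod_list (map N (replicate i g @ (\<lambda>x. f x - g x) # replicate (m - Suc i) f))
      = N g ^ i * N f ^ (m - Suc i) * N (\<lambda>x. f x - g x)"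
      by (simp add: prod_list_replicate)
    also have "\<dots> \<le> R ^ i * R ^ (m - Suc i) * N (\<lambda>x. f x - g x)"
      using fg R by (intro mult_right_mono mult_mono power_mono) auto
    also have "R ^ i * R ^ (m - Suc i) = R ^ (m - 1)" using that by (simp flip: power_add)
    finally show ?thesis using K(1) by (simp add: mult_right_mono mult_ac)
  qed
  then have "(\<Sum>i<m. cmod (T (replicate i g @ (\<lambda>x. f x - g x) # replicate (m - Suc i) f)))
    \<le> (\<Sum>i<m. K * R ^ (m - 1) * N (\<lambda>x. f x - g x))"
    by (intro sum_mono) auto
  then show ?thesis unfolding mlin_replicate_diff[OF mlin fg(1,2)]
    by (intro order_trans[OF norm_sum]) (simp add: mult_ac)
qed

text \<open>The varied entry falls into exactly one chunk, as the assumption on the sum prevents it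
  from being cut off. The surrounding pieces are chosen before \<open>w\<close>, so that linearity
  in \<open>w\<close> can be tested inside that chunk alone.\<close>

lemma chunks_split:
  assumes "sum_list c = length xs + Suc (length ys)"
  shows "\<exists>ps us ws qs. set us \<subseteq> set xs \<and> set ws \<subseteq> set ys \<and> (\<forall>w. chunks c (xs @ w # ys) = ps @ (us @ w # ws) # qs)"
  using assms
proof (induction c arbitrary: xs)
  case (Cons i c)
  show ?case
  proof (cases "i \<le> length xs")
    case True
    then have "sum_list c = length (drop i xs) + Suc (length ys)" using Cons.prems by simp
    from Cons.IH[OF this] obtain ps us ws qs where *: "set us \<subseteq> set (drop i xs)" "set ws \<subseteq> set ys"
      "\<forall>w. chunks c (drop i xs @ w # ys) = ps @ (us @ w # ws) # qs" by blast
    have "\<forall>w. chunks (i # c) (xs @ w # ys) = (take i xs # ps) @ (us @ w # ws) # qs"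
      using True * by simp
    moreover have "set us \<subseteq> set xs" using *(1) set_drop_subset by fast
    ultimately show ?thesis using *(2) by blast
  next
    case False
    then obtain k where k: "i = length xs + Suc k" by (metis add_Suc_right less_imp_Suc_add not_le)
    have "\<forall>w. chunks (i # c) (xs @ w # ys) = [] @ (xs @ w # take k ys) # chunks c (drop k ys)"
      by (simp add: k)
    moreover have "set (take k ys) \<subseteq> set ys" by (rule set_take_subset)
    ultimately show ?thesis by blast
  qed
qed simp

lemma chunks_replicate:
  "sum_list c = n \<Longrightarrow> chunks c (replicate n x) = map (\<lambda>i. replicate i x) c"
  by (induction c arbitrary: n) auto

lemma sum_list_eq_length:
  assumes "\<forall>i\<in>set c. 1 \<le> i" "sum_list c = length c"
  shows "c = replicate (length c) (1::nat)"
  using assms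
proof (induction c)
  case (Cons i c)
  have "length c \<le> sum_list c" using Cons.prems(1) by (induction c) auto
  with Cons show ?case by auto
qed simp

text \<open>This identifies the top term \<open>m = n\<close> in a sum over compositions of
  \<open>n\<close>: every inner operator there is the linear one.\<close>

lemma comps_self: "comps n n = {replicate n 1}"
proof (intro equalityI subsetI)
  fix c assume "c \<in> comps n n"
  then show "c \<in> {replicate n 1}" using sum_list_eq_length[of c] by (simp add: comps_def)
qed (auto simp: comps_def sum_list_replicate)

section \<open>The inverse Born operators as multilinear maps\<close>

locale inverse_born = born A NX B NY K J nu mu C
  for A :: "'v set" and NX and B :: "'y set" and NY K J nu mu C +
  fixes L :: "('y \<Rightarrow> complex) list \<Rightarrow> 'v \<Rightarrow> complex"
  assumes L_1: "phi \<in> supp_in B \<Longrightarrow> L [phi] = J phi"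
    and L_rec: "2 \<le> length phis \<Longrightarrow> L phis = (\<lambda>v. - (\<Sum>m\<in>{1..<length phis}. \<Sum>c\<in>comps m (length phis).
               L (map (\<lambda>ch. K (map J ch)) (chunks c phis)) v))"
begin

text \<open>Strong induction on the degree. In each term of the recursion the varied entry lies in
  one chunk; there it passes linearly through \<open>J\<close> and \<open>K\<close>, and the outer
  operator has lower degree \<open>m < n\<close>.\<close>

lemma L_mlin: "mlin B n (\<lambda>fs. L fs v)"
proof (induction n rule: less_induct)
  case (less n)
  show ?case unfolding mlin_def
  proof (intro allI impI)
    fix xs ys :: "('y \<Rightarrow> complex) list" and f g :: "'y \<Rightarrow> complex" and a b
    assume xs: "set xs \<subseteq> supp_in B" and ys: "set ys \<subseteq> supp_in B" and fg: "f \<in> supp_in B" "g \<in> supp_in B"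
      and len: "Suc (length xs + length ys) = n"
    let ?h = "\<lambda>x. a * f x + b * g x"
    show "L (xs @ ?h # ys) v = a * L (xs @ f # ys) v + b * L (xs @ g # ys) v"
    proof (cases "n = 1")
      case True
      then show ?thesis using len fg J_lin[OF fg, of a b] by (simp add: L_1 supp_in_add supp_in_scale)
    next
      case False
      define T where "T c w = L (map (\<lambda>ch. K (map J ch)) (chunks c (xs @ w # ys))) v" for c w
      have T: "T c ?h = a * T c f + b * T c g" if c: "m < n" "c \<in> comps m n" for m c
      proof -
        have "sum_list c = length xs + Suc (length ys)" using c len by (simp add: comps_def)
        from chunks_split[OF this] obtain ps us ws qs where *: "set us \<subseteq> set xs" "set ws \<subseteq> set ys"
          "\<And>w. chunks c (xs @ w # ys) = ps @ (us @ w # ws) # qs" by blast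
        let ?H = "\<lambda>ch. K (map J ch)"
        have "length (chunks c (xs @ f # ys)) = m" using c by (simp add: comps_def)
        then have m: "Suc (length (map ?H ps) + length (map ?H qs)) = m" by (simp add: *(3))
        have H: "?H (us @ ?h # ws) = (\<lambda>y. a * ?H (us @ f # ws) y + b * ?H (us @ g # ws) y)"
        proof
          fix y
          have "K (map J us @ (\<lambda>x. a * J f x + b * J g x) # map J ws) y
            = a * K (map J us @ J f # map J ws) y + b * K (map J us @ J g # map J ws) y"
            using *(1,2) xs ys fg by (intro mlin_lin[OF K_mlin[of "Suc (length us + length ws)"]]) (auto intro!: J_supp)
          then show "?H (us @ ?h # ws) y = a * ?H (us @ f # ws) y + b * ?H (us @ g # ws) y"
            by (simp add: J_lin fg)
        qed
        show ?thesis
          unfolding T_def *(3) map_append[of ?H] list.map(2)[of ?H] H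
          by (rule mlin_lin[OF less.IH[OF c(1)] _ _ K_supp K_supp m]) (auto intro: K_supp)
      qed
      have rec: "L (xs @ w # ys) v = - (\<Sum>m\<in>{1..<n}. \<Sum>c\<in>comps m n. T c w)" for w
        using L_rec[of "xs @ w # ys"] False len by (simp add: T_def)
      have "(\<Sum>m\<in>{1..<n}. \<Sum>c\<in>comps m n. T c ?h) = (\<Sum>m\<in>{1..<n}. \<Sum>c\<in>comps m n. a * T c f + b * T c g)"
        by (intro sum.cong refl T) auto
      then show ?thesis unfolding rec by (simp add: sum.distrib sum_distrib_left)
    qed
  qed
qed

lemma L_replicate_scale:
  assumes "f \<in> supp_in B"
  shows "L (replicate m (\<lambda>y. z * f y)) v = z ^ m * L (replicate m f) v"
  using mlin_replicate_scale[OF L_mlin[of m v] assms, of "[]" m z] by simp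

lemma L_bounded:
  "\<exists>D\<ge>0. \<forall>fs. length fs = m \<and> set fs \<subseteq> supp_in B \<longrightarrow> cmod (L fs v) \<le> D * prod_list (map NY fs)"
  by (rule Y.mlin_bounded[OF L_mlin])

text \<open>For \<open>j \<ge> 2\<close> this is the recursion with all arguments equal to
  \<open>K [xi]\<close>, which \<open>J\<close> sends back to \<open>xi\<close>: the term
  \<open>m = j\<close> cancels the others. The left side is the part of degree \<open>j\<close> in
  \<open>xi\<close> of the formal composition of the inverse series with the forward series.\<close>

lemma L_left_inverse:
  assumes xi: "xi \<in> supp_in A" and j: "1 \<le> j"
  shows "(\<Sum>m=1..j. \<Sum>c\<in>comps m j. L (map (\<lambda>i. K (replicate i xi)) c) v) = (if j = 1 then xi v else 0)"
proof (cases "j = 1")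
  case True
  then show ?thesis using L_1[OF K_supp] J_K[OF xi] comps_self[of 1] by simp
next
  case False
  have "L (replicate j (K [xi])) v = - (\<Sum>m\<in>{1..<j}. \<Sum>c\<in>comps m j. L (map (\<lambda>i. K (replicate i xi)) c) v)"
  proof -
    have "map (\<lambda>ch. K (map J ch)) (chunks c (replicate j (K [xi]))) = map (\<lambda>i. K (replicate i xi)) c"
      if "c \<in> comps m j" for m c
      using that chunks_replicate[of c j "K [xi]"] J_K[OF xi] by (simp add: comps_def)
    then show ?thesis using L_rec[of "replicate j (K [xi])"] False j by simp
  qed
  moreover have "{1..j} = insert j {1..<j}" using j by auto
  ultimately show ?thesis using False comps_self[of j] by (simp add: map_replicate)
qed

section \<open>Composition of the truncated series\<close>

definition Ktrunc :: "nat \<Rightarrow> ('v \<Rightarrow> complex) \<Rightarrow> 'y \<Rightarrow> complex" where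
  "Ktrunc n xi = (\<lambda>y. \<Sum>i=1..n. K (replicate i xi) y)"

lemma Ktrunc_supp: "Ktrunc n xi \<in> supp_in B"
  unfolding Ktrunc_def by (intro supp_in_sum K_supp)

text \<open>Both series are cut at order \<open>n\<close>, so only finitely many index words
  \<open>c\<close> occur. Grouped by total degree \<open>sum_list c\<close>, those of degree at most
  \<open>n\<close> collapse to \<open>xi v\<close> by \<open>L_left_inverse\<close>; the others
  carry at least \<open>n + 1\<close> factors \<open>NX xi\<close>, which is at most 1.\<close>

lemma L_Ktrunc:
  assumes n: "1 \<le> n"
  shows "\<exists>D\<ge>0. \<forall>xi\<in>supp_in A. NX xi \<le> 1 \<longrightarrow>
    cmod ((\<Sum>m=1..n. L (replicate m (Ktrunc n xi)) v) - xi v) \<le> D * NX xi ^ Suc n"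
proof -
  obtain Km where Km: "\<And>m. Km m \<ge> 0"
    "\<And>m fs. length fs = m \<Longrightarrow> set fs \<subseteq> supp_in B \<Longrightarrow> cmod (L fs v) \<le> Km m * prod_list (map NY fs)"
    using L_bounded[of _ v] by metis
  define Z where "Z = {c. set c \<subseteq> {1..n} \<and> length c \<in> {1..n}}"
  have Z_eq: "Z = (\<Union>m\<in>{1..n}. {c. set c \<subseteq> {1..n} \<and> length c = m})" by (auto simp: Z_def)
  have finZm: "finite {c. set c \<subseteq> {1..n} \<and> length c = m}" for m by (simp add: finite_lists_length_eq)
  have finZ: "finite Z" unfolding Z_eq using finZm by blast
  \<comment> \<open>The coefficient of \<open>NX xi ^ sum_list c\<close> in the bound for the term
    of the word \<open>c\<close>. It does not depend on \<open>xi\<close>, so its sum over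
    \<open>Z\<close> can serve as the constant.\<close>
  define w where "w c = Km (length c) * prod_list (map (\<lambda>i. nu * mu ^ (i - 1)) c)" for c
  have w_nn: "0 \<le> w c" for c
    unfolding w_def using nu_pos mu_pos Km(1) by (intro mult_nonneg_nonneg prod_list_nonneg) auto
  show ?thesis
  proof (intro exI conjI ballI impI)
    show "0 \<le> (\<Sum>c\<in>Z. w c)" using w_nn by (intro sum_nonneg) auto
    fix xi assume xi: "xi \<in> supp_in A" "NX xi \<le> 1"
    define F where "F c = L (map (\<lambda>i. K (replicate i xi)) c) v" for c
    have F_bound: "cmod (F c) \<le> w c * NX xi ^ sum_list c" if "c \<in> Z" for c
    proof -
      have "cmod (F c) \<le> Km (length c) * prod_list (map (\<lambda>i. NY (K (replicate i xi))) c)"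
        using Km(2)[of "map (\<lambda>i. K (replicate i xi)) c" "length c"] K_supp by (auto simp: F_def comp_def)
      also have "prod_list (map (\<lambda>i. NY (K (replicate i xi))) c)
        \<le> prod_list (map (\<lambda>i. nu * mu ^ (i - 1)) c) * NX xi ^ sum_list c"
      proof -
        have "set c \<subseteq> {1..n}" using that by (simp add: Z_def)
        then show ?thesis
        proof (induction c)
          case (Cons i c)
          then obtain k where k: "i = Suc k" by (cases i) auto
          have "NY (K (replicate i xi)) * prod_list (map (\<lambda>i. NY (K (replicate i xi))) c)
            \<le> (nu * mu ^ k * NX xi ^ Suc k) * (prod_list (map (\<lambda>i. nu * mu ^ (i - 1)) c) * NX xi ^ sum_list c)"
            using K_replicate_bound[OF xi(1) order_refl, of k] Cons nu_pos mu_pos unfolding k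
            by (intro mult_mono) (auto intro!: prod_list_nonneg simp del: replicate_Suc)
          then show ?case by (simp add: k power_add mult_ac)
        qed simp
      qed
      finally show ?thesis using Km(1) by (simp add: w_def mult_right_mono mult_ac)
    qed
    have "(\<Sum>m=1..n. L (replicate m (Ktrunc n xi)) v) = (\<Sum>m=1..n. \<Sum>c | set c \<subseteq> {1..n} \<and> length c = m. F c)"
      unfolding F_def Ktrunc_def
      using mlin_expand[OF L_mlin, of "{1..n}" "\<lambda>i. K (replicate i xi)" "[]"] K_supp
      by (intro sum.cong) auto
    also have "\<dots> = (\<Sum>c\<in>Z. F c)"
      unfolding Z_eq using finZm by (intro sum.UNION_disjoint[symmetric]) auto
    also have "Z = {c\<in>Z. sum_list c \<le> n} \<union> {c\<in>Z. n < sum_list c}" by auto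
    also have "(\<Sum>c\<in>\<dots>. F c) = (\<Sum>c\<in>{c\<in>Z. sum_list c \<le> n}. F c) + (\<Sum>c\<in>{c\<in>Z. n < sum_list c}. F c)"
      using finZ by (intro sum.union_disjoint) auto
    also have "(\<Sum>c\<in>{c\<in>Z. sum_list c \<le> n}. F c) = xi v"
    proof -
      have ge: "length c \<le> sum_list c" if "set c \<subseteq> {1..n}" for c using that by (induction c) auto
      have "(\<Sum>c\<in>{c\<in>Z. sum_list c \<le> n}. F c)
        = (\<Sum>j=1..n. \<Sum>c | c \<in> {c\<in>Z. sum_list c \<le> n} \<and> sum_list c = j. F c)"
      proof (rule sum.group[symmetric])
        show "sum_list ` {c\<in>Z. sum_list c \<le> n} \<subseteq> {1..n}" using ge by (force simp: Z_def)
      qed (use finZ in auto)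
      also have "\<dots> = (\<Sum>j=1..n. \<Sum>m=1..j. \<Sum>c\<in>comps m j. F c)"
      proof (rule sum.cong[OF refl])
        fix j assume j: "j \<in> {1..n}"
        let ?Zj = "{c. c \<in> {c\<in>Z. sum_list c \<le> n} \<and> sum_list c = j}"
        have "(\<Sum>c\<in>?Zj. F c) = (\<Sum>m=1..j. \<Sum>c | c \<in> ?Zj \<and> length c = m. F c)"
        proof (rule sum.group[symmetric])
          show "length ` ?Zj \<subseteq> {1..j}" using ge by (force simp: Z_def)
        qed (use finZ in auto)
        also have "\<dots> = (\<Sum>m=1..j. \<Sum>c\<in>comps m j. F c)"
        proof (intro sum.cong refl)
          fix m assume "m \<in> {1..j}"
          \<comment> \<open>A word of positive entries with total degree \<open>j \<le> n\<close>
            has entries at most \<open>n\<close>, so the cutoffs in \<open>Z\<close> remove no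
            composition of \<open>j\<close>.\<close>
          moreover have "i \<le> n" if "i \<in> set c" "sum_list c = j" for i c
            using member_le_sum_list[OF that(1)] that(2) j by simp
          ultimately show "{c. c \<in> ?Zj \<and> length c = m} = comps m j"
            using j by (auto simp: comps_def Z_def subset_iff)
        qed
        finally show "(\<Sum>c\<in>?Zj. F c) = (\<Sum>m=1..j. \<Sum>c\<in>comps m j. F c)" .
      qed
      also have "\<dots> = (\<Sum>j=1..n. if j = 1 then xi v else 0)"
        unfolding F_def using L_left_inverse[OF xi(1)] by (intro sum.cong) auto
      also have "\<dots> = xi v" using n by simp
      finally show ?thesis .
    qed
    finally have "cmod ((\<Sum>m=1..n. L (replicate m (Ktrunc n xi)) v) - xi v) = cmod (\<Sum>c\<in>{c\<in>Z. n < sum_list c}. F c)"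
      by simp
    also have "\<dots> \<le> (\<Sum>c\<in>{c\<in>Z. n < sum_list c}. w c * NX xi ^ Suc n)"
    proof (rule order_trans[OF norm_sum sum_mono])
      fix c assume c: "c \<in> {c\<in>Z. n < sum_list c}"
      have "cmod (F c) \<le> w c * NX xi ^ sum_list c" using c F_bound by simp
      also have "\<dots> \<le> w c * NX xi ^ Suc n"
        using c xi w_nn by (intro mult_left_mono power_decreasing) auto
      finally show "cmod (F c) \<le> w c * NX xi ^ Suc n" .
    qed
    also have "\<dots> \<le> (\<Sum>c\<in>Z. w c * NX xi ^ Suc n)"
      using finZ w_nn by (intro sum_mono2) auto
    finally show "cmod ((\<Sum>m=1..n. L (replicate m (Ktrunc n xi)) v) - xi v) \<le> (\<Sum>c\<in>Z. w c) * NX xi ^ Suc n"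
      by (simp add: sum_distrib_right)
  qed
qed

text \<open>Truncation omits the tail beyond order \<open>n\<close>, which is dominated by a
  geometric series with ratio \<open>mu * NX xi \<le> 1/2\<close>; hence the factor 2.\<close>

lemma Ktrunc_approx:
  assumes xi: "xi \<in> supp_in A" "mu * NX xi \<le> 1/2"
  shows "NY (\<lambda>y. Ktrunc n xi y - (K [xi] y + G xi y)) \<le> 2 * nu * mu ^ n * NX xi ^ Suc n"
proof -
  have s: "(\<lambda>j. K (replicate (Suc (j + n)) xi) y) sums (K [xi] y + G xi y - Ktrunc n xi y)" for y
  proof -
    have "(\<lambda>j. K (replicate (Suc (j + n)) xi) y) sums (K [xi] y + G xi y - (\<Sum>i<n. K (replicate (Suc i) xi) y))"
      using sums_split_initial_segment[OF K1_add_G_sums] xi by simp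
    then show ?thesis by (simp add: Ktrunc_def sum.atLeast1_atMost_eq del: replicate_Suc)
  qed
  have "(\<lambda>j. (nu * mu ^ n * NX xi ^ Suc n) * (mu * NX xi) ^ j) sums ((nu * mu ^ n * NX xi ^ Suc n) * (1 / (1 - mu * NX xi)))"
    using xi mu_pos by (intro sums_mult geometric_sums) auto
  then have g: "summable (\<lambda>j. (nu * mu ^ n * NX xi ^ Suc n) * (mu * NX xi) ^ j)"
    "(\<Sum>j. (nu * mu ^ n * NX xi ^ Suc n) * (mu * NX xi) ^ j) = (nu * mu ^ n * NX xi ^ Suc n) * (1 / (1 - mu * NX xi))"
    by (simp_all only: sums_iff)
  have "NY (\<lambda>y. \<Sum>j. K (replicate (Suc (j + n)) xi) y) \<le> (\<Sum>j. (nu * mu ^ n * NX xi ^ Suc n) * (mu * NX xi) ^ j)"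
  proof (rule Y.suminf_le[OF _ _ g(1)])
    show "summable (\<lambda>j. K (replicate (Suc (j + n)) xi) y)" for y using s by (rule sums_summable)
    show "NY (K (replicate (Suc (j + n)) xi)) \<le> (nu * mu ^ n * NX xi ^ Suc n) * (mu * NX xi) ^ j" for j
      using K_replicate_bound[OF xi(1) order_refl, of "j + n"]
      by (simp add: power_add power_mult_distrib mult_ac del: replicate_Suc)
  qed
  also have "(\<lambda>y. \<Sum>j. K (replicate (Suc (j + n)) xi) y) = (\<lambda>y. (K [xi] y + G xi y) - Ktrunc n xi y)"
    using sums_unique[OF s] by (intro ext) simp
  also have "(\<Sum>j. (nu * mu ^ n * NX xi ^ Suc n) * (mu * NX xi) ^ j) \<le> (nu * mu ^ n * NX xi ^ Suc n) * 2"
    unfolding g(2) using xi nu_pos mu_pos by (intro mult_left_mono) (auto simp: divide_le_eq)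
  finally show ?thesis using Y.diff_commute[of "Ktrunc n xi"] by (simp add: mult_ac)
qed

text \<open>At the solution \<open>xi\<close> for the data \<open>z * phi\<close> the full forward
  series returns \<open>z * phi\<close>, so \<open>Ktrunc n xi\<close> differs from it by order
  \<open>n + 1\<close> in \<open>z\<close>. Replacing one by the other in \<open>L_Ktrunc\<close>
  costs a term of the same order, and multilinearity turns the sum into a polynomial in
  \<open>z\<close>.\<close>

lemma sol_approx:
  assumes phi: "phi \<in> supp_in B" and n: "1 \<le> n"
  shows "\<exists>D delta. 0 < delta \<and> (\<forall>z. cmod z \<le> delta \<longrightarrow>
    cmod ((\<Sum>m=1..n. L (replicate m phi) v * z ^ m) - sol (\<lambda>y. z * phi y) v) \<le> D * cmod z ^ Suc n)"
proof -
  \<comment> \<open>A fixed level below \<open>rs\<close>, here half of it, lets one radius serve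
    all small \<open>z\<close>.\<close>
  obtain rho where rho: "0 \<le> rho" "rho < Rs" "rs / 2 \<le> major rho"
    using obtain_rho[of "rs / 2"] rs_pos by auto
  define c where "c = NY phi / (C * (1 - kappa rho))"
  have c: "c \<ge> 0" using less_Rs[OF rho(1,2)] C_pos by (simp add: c_def)
  obtain D1 where D1: "D1 \<ge> 0" "\<And>xi. xi \<in> supp_in A \<Longrightarrow> NX xi \<le> 1 \<Longrightarrow>
    cmod ((\<Sum>m=1..n. L (replicate m (Ktrunc n xi)) v) - xi v) \<le> D1 * NX xi ^ Suc n"
    using L_Ktrunc[OF n] by blast
  obtain Km where Km: "\<And>m. Km m \<ge> 0"
    "\<And>m fs. length fs = m \<Longrightarrow> set fs \<subseteq> supp_in B \<Longrightarrow> cmod (L fs v) \<le> Km m * prod_list (map NY fs)"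
    using L_bounded[of _ v] by metis
  \<comment> \<open>\<open>P\<close> will bound the norms of both \<open>z * phi\<close> and
    \<open>Ktrunc n xi\<close>, giving the common ball on which the Lipschitz bound for the terms of
    \<open>L\<close> is taken.\<close>
  define P where "P = rs / 2 + 2 * nu * mu ^ n"
  define D2 where "D2 = (\<Sum>m=1..n. real m * Km m * P ^ (m - 1))"
  have D2: "D2 \<ge> 0" unfolding D2_def P_def
    using Km(1) rs_pos nu_pos mu_pos by (intro sum_nonneg mult_nonneg_nonneg zero_le_power add_nonneg_nonneg) auto
  \<comment> \<open>The three entries ensure that \<open>z * phi\<close> has norm at most
    \<open>rs / 2\<close>, that \<open>NX xi \<le> 1\<close>, and that
    \<open>mu * NX xi \<le> 1/2\<close>; the added 1 keeps the denominators positive.\<close>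
  define delta where "delta = min (rs / 2 / (NY phi + 1)) (min (1 / (c + 1)) (1 / (2 * mu * (c + 1))))"
  have "NY phi + 1 > 0" by (simp add: add_nonneg_pos)
  then have delta: "delta > 0" using rs_pos mu_pos c by (auto simp: delta_def)
  show ?thesis
  proof (intro exI conjI allI impI)
    show "0 < delta" by (rule delta)
    fix z assume z: "cmod z \<le> delta"
    define xi where "xi = sol (\<lambda>y. z * phi y)"
    have zphi: "(\<lambda>y. z * phi y) \<in> supp_in B" using phi by (rule supp_in_scale)
    have z': "cmod z \<le> rs / 2 / (NY phi + 1)" "cmod z \<le> 1 / (c + 1)" "cmod z \<le> 1 / (2 * mu * (c + 1))"
      using z by (simp_all only: delta_def min.bounded_iff)
    have cp: "c + 1 > 0" "2 * mu * (c + 1) > 0" using c mu_pos by auto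
    have "cmod z * (NY phi + 1) \<le> rs / 2" using z'(1) \<open>NY phi + 1 > 0\<close> by (simp only: pos_le_divide_eq)
    moreover have "cmod z * NY phi \<le> cmod z * (NY phi + 1)" by (simp add: mult_left_mono)
    ultimately have Nz: "NY (\<lambda>y. z * phi y) \<le> rs / 2" by (simp add: Y.scale)
    then have le: "NY (\<lambda>y. z * phi y) \<le> major rho" using rho by simp
    have xi: "xi \<in> supp_in A" unfolding xi_def by (rule sol_supp[OF zphi])
    have "NX xi \<le> NY (\<lambda>y. z * phi y) / (C * (1 - kappa rho))"
      unfolding xi_def by (rule sol_small[OF zphi le rho(1,2)])
    then have small: "NX xi \<le> c * cmod z" by (simp add: c_def Y.scale mult_ac)
    have "cmod z * (c + 1) \<le> 1" using z'(2) cp by (simp only: pos_le_divide_eq)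
    moreover have "c * cmod z \<le> cmod z * (c + 1)" by (simp add: algebra_simps)
    ultimately have xi1: "NX xi \<le> 1" using small by linarith
    have "cmod z * (2 * mu * (c + 1)) \<le> 1" using z'(3) cp by (simp only: pos_le_divide_eq)
    moreover have "2 * mu * (c * cmod z) \<le> 2 * mu * (cmod z * (c + 1))" using mu_pos by (intro mult_left_mono) (auto simp: algebra_simps)
    moreover have "2 * mu * NX xi \<le> 2 * mu * (c * cmod z)" using small mu_pos by (intro mult_left_mono) auto
    ultimately have xi2: "mu * NX xi \<le> 1/2" by (simp add: mult_ac)
    have "step (\<lambda>y. z * phi y) xi = xi" unfolding xi_def by (rule sol_fixed[OF zphi le rho(1,2)])
    then have "K [xi] y + G xi y = z * phi y" for y using step_fixed_iff[OF zphi xi] by simp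
    then have trunc: "NY (\<lambda>y. Ktrunc n xi y - z * phi y) \<le> 2 * nu * mu ^ n * NX xi ^ Suc n"
      using Ktrunc_approx[OF xi xi2, of n] by simp
    have "2 * nu * mu ^ n * NX xi ^ Suc n \<le> 2 * nu * mu ^ n * 1"
      using nu_pos mu_pos xi1 by (intro mult_left_mono power_le_one) auto
    then have PT: "NY (Ktrunc n xi) \<le> P"
      using Y.le_add_diff[of "Ktrunc n xi" "\<lambda>y. z * phi y"] trunc Nz by (simp add: P_def)
    have "2 * nu * mu ^ n > 0" using nu_pos mu_pos by simp
    then have Pz: "NY (\<lambda>y. z * phi y) \<le> P" using Nz unfolding P_def by linarith
    have "cmod ((\<Sum>m=1..n. L (replicate m (Ktrunc n xi)) v) - (\<Sum>m=1..n. L (replicate m (\<lambda>y. z * phi y)) v))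
      \<le> (\<Sum>m=1..n. real m * Km m * P ^ (m - 1) * NY (\<lambda>y. Ktrunc n xi y - z * phi y))"
      unfolding sum_subtractf[symmetric]
      by (intro order_trans[OF norm_sum] sum_mono Y.mlin_replicate_diff_bound[OF L_mlin Km(1,2) Ktrunc_supp zphi PT Pz])
    also have "\<dots> = D2 * NY (\<lambda>y. Ktrunc n xi y - z * phi y)" by (simp add: D2_def sum_distrib_right)
    also have "\<dots> \<le> D2 * (2 * nu * mu ^ n * NX xi ^ Suc n)" using D2 trunc by (intro mult_left_mono)
    finally have 1: "cmod ((\<Sum>m=1..n. L (replicate m (Ktrunc n xi)) v) - (\<Sum>m=1..n. L (replicate m (\<lambda>y. z * phi y)) v))
      \<le> D2 * (2 * nu * mu ^ n) * NX xi ^ Suc n" by (simp add: mult_ac)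
    have "L (replicate m (\<lambda>y. z * phi y)) v = L (replicate m phi) v * z ^ m" for m
      using L_replicate_scale[OF phi] by simp
    then have "cmod ((\<Sum>m=1..n. L (replicate m phi) v * z ^ m) - xi v) \<le> (D2 * (2 * nu * mu ^ n) + D1) * NX xi ^ Suc n"
      using 1 D1(2)[OF xi xi1] norm_triangle_ineq[of
        "(\<Sum>m=1..n. L (replicate m (\<lambda>y. z * phi y)) v) - (\<Sum>m=1..n. L (replicate m (Ktrunc n xi)) v)"
        "(\<Sum>m=1..n. L (replicate m (Ktrunc n xi)) v) - xi v"]
      by (simp add: norm_minus_commute distrib_right)
    also have "\<dots> \<le> (D2 * (2 * nu * mu ^ n) + D1) * (c * cmod z) ^ Suc n"
      using D1 D2 nu_pos mu_pos small by (intro mult_left_mono power_mono) auto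
    finally show "cmod ((\<Sum>m=1..n. L (replicate m phi) v * z ^ m) - sol (\<lambda>y. z * phi y) v)
      \<le> ((D2 * (2 * nu * mu ^ n) + D1) * c ^ Suc n) * cmod z ^ Suc n"
      by (simp add: xi_def power_mult_distrib mult_ac)
  qed
qed

section \<open>The Taylor series of the solution along a complex line\<close>

lemma sol_disc_holomorphic:
  assumes phi: "phi \<in> supp_in B" and r: "r * NY phi < rs"
  shows "(\<lambda>z. sol (\<lambda>y. z * phi y) v) holomorphic_on ball 0 r"
proof -
  obtain rho where rho: "0 \<le> rho" "rho < Rs" "r * NY phi \<le> major rho" using obtain_rho[OF r] .
  show ?thesis
  proof (rule sol_holomorphic[OF open_ball phi rho(1,2)])
    fix z assume "z \<in> ball (0::complex) r"
    then have "cmod z * NY phi \<le> r * NY phi" by (intro mult_right_mono) auto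
    then show "cmod z * NY phi \<le> major rho" using rho by simp
  qed
qed

lemma sol_deriv:
  assumes phi: "phi \<in> supp_in B" and n: "1 \<le> n"
  shows "(deriv ^^ n) (\<lambda>z. sol (\<lambda>y. z * phi y) v) 0 / fact n = L (replicate n phi) v"
proof -
  obtain D delta where "0 < delta" "\<And>z. cmod z \<le> delta \<Longrightarrow>
    cmod ((\<Sum>m=1..n. L (replicate m phi) v * z ^ m) - sol (\<lambda>y. z * phi y) v) \<le> D * cmod z ^ Suc n"
    using sol_approx[OF assms, of v] by blast
  moreover define r where "r = rs / (NY phi + 1)"
  have "NY phi + 1 > 0" by (simp add: add_nonneg_pos)
  then have r: "r > 0" "r * NY phi < rs" using rs_pos by (auto simp: r_def field_simps)
  ultimately show ?thesis
    by (intro deriv_eq_coeff_of_approx[OF sol_disc_holomorphic[OF phi r(2)] r(1) _ n]) auto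
qed

lemma sol_ball_Rs:
  assumes "phi \<in> supp_in B" "NY phi < rs"
  shows "NX (sol phi) < Rs"
proof -
  obtain rho where rho: "0 \<le> rho" "rho < Rs" "NY phi \<le> major rho" using obtain_rho[OF assms(2)] .
  then show ?thesis using sol_ball[OF assms(1) rho(3,1,2)] by linarith
qed

lemma sol_zero: "sol (\<lambda>_. 0) v = 0"
proof -
  obtain rho where rho: "0 \<le> rho" "rho < Rs" "0 \<le> major rho" using obtain_rho[OF rs_pos] .
  have "NX (sol (\<lambda>_. 0)) \<le> 0" using sol_small[of "\<lambda>_. 0" rho] rho by simp
  then have "sol (\<lambda>_. 0) = (\<lambda>_. 0)" by (intro X.eqI) (auto intro: sol_supp)
  then show ?thesis by simp
qed

text \<open>This makes room for a closed disc of radius \<open>r\<close> inside an open disc of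
  holomorphy; if \<open>phi\<close> has norm 0, every radius is allowed.\<close>

lemma obtain_larger_radius:
  assumes "r * NY phi < rs"
  obtains r' where "r < r'" "r' * NY phi < rs"
proof (cases "NY phi = 0")
  case True
  then show ?thesis using that[of "r + 1"] rs_pos by simp
next
  case False
  then have pos: "NY phi > 0" using Y.nonneg[of phi] by linarith
  then have "r < rs / NY phi" using assms by (simp add: field_simps)
  then obtain r' where "r < r'" "r' < rs / NY phi" using dense by blast
  then show ?thesis using that pos by (simp add: field_simps)
qed

text \<open>The Taylor series about 0 of the solution for \<open>z * phi\<close> is evaluated at
  \<open>z = 1\<close>, which lies inside a disc of holomorphy of radius larger than 1.
  \<open>sol_zero\<close> removes the constant term, so the series starts at order one.\<close>

lemma L_sums_sol:
  assumes phi: "phi \<in> supp_in B" and lt: "NY phi < rs"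
  shows "(\<lambda>m. L (replicate (Suc m) phi) v) sums sol phi v"
proof -
  define f where "f = (\<lambda>z. sol (\<lambda>y. z * phi y) v)"
  obtain r where r: "1 < r" "r * NY phi < rs" using obtain_larger_radius[of 1 phi] lt by auto
  define a where "a n = (deriv ^^ n) f 0 / fact n" for n
  have "(\<lambda>n. a n * (1 - 0) ^ n) sums f 1"
    unfolding a_def using r sol_disc_holomorphic[OF phi r(2)]
    by (intro holomorphic_power_series[of _ _ r]) (auto simp: f_def)
  moreover have "a 0 = 0" using sol_zero[of v] by (simp add: a_def f_def)
  ultimately have "(\<lambda>n. a (Suc n)) sums f 1" using sums_Suc_iff[of a "f 1"] by simp
  moreover have "a (Suc n) = L (replicate (Suc n) phi) v" for n
    unfolding a_def f_def by (rule sol_deriv[OF phi]) simp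
  ultimately show ?thesis by (simp add: f_def)
qed

section \<open>Cauchy estimates and the truncation error\<close>

context
  fixes M
  assumes M: "\<And>phi. phi \<in> supp_in B \<Longrightarrow> NY phi < rs \<Longrightarrow> NX (sol phi) \<le> M"
begin

text \<open>Cauchy's inequality on the circle of radius \<open>r\<close>: there
  \<open>z * phi\<close> still has norm below \<open>rs\<close>, so \<open>M\<close> bounds the
  solution.\<close>

lemma L_Cauchy_bound:
  assumes phi: "phi \<in> supp_in B" and r: "0 < r" "r * NY phi < rs" and v: "v \<in> A" and m: "1 \<le> m"
  shows "cmod (L (replicate m phi) v) \<le> M / r ^ m"
proof -
  define f where "f = (\<lambda>z. sol (\<lambda>y. z * phi y) v)"
  obtain r' where r': "r < r'" "r' * NY phi < rs" using obtain_larger_radius[OF r(2)] .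
  have hol: "f holomorphic_on ball 0 r'" unfolding f_def by (rule sol_disc_holomorphic[OF phi r'(2)])
  have "cmod ((deriv ^^ m) f 0) \<le> fact m * M / r ^ m"
  proof (rule Cauchy_inequality)
    show "f holomorphic_on ball 0 r" "continuous_on (cball 0 r) f"
      using r' by (auto intro!: holomorphic_on_imp_continuous_on holomorphic_on_subset[OF hol])
    fix z assume "cmod (0 - z) = r"
    then have "NX (sol (\<lambda>y. z * phi y)) \<le> M" using r phi by (intro M supp_in_scale) (auto simp: Y.scale)
    then show "cmod (f z) \<le> M" using X.component_le[OF v] order_trans unfolding f_def by blast
  qed (fact r(1))
  then show ?thesis
    unfolding sol_deriv[OF phi m, symmetric] f_def by (simp add: norm_divide field_simps)
qed

lemma sol_partial_sum_error:
  assumes phi: "phi \<in> supp_in B" and tau: "0 < tau" "tau < 1" and lt: "NY phi < tau * rs" and N: "1 \<le> N" and v: "v \<in> A"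
  shows "cmod (sol phi v - (\<Sum>m=1..N. L (replicate m phi) v))
    \<le> M * (NY phi / (tau * rs)) ^ N * (1 / (1 - NY phi / (tau * rs)))"
proof -
  define x where "x = NY phi / (tau * rs)"
  have x: "0 \<le> x" "x < 1" using lt tau rs_pos by (auto simp: x_def)
  have M0: "M \<ge> 0" using M[of "\<lambda>_. 0"] rs_pos by (simp add: order_trans[OF X.nonneg])
  have trs: "tau * rs < rs" using tau rs_pos by simp
  have Lm: "cmod (L (replicate m phi) v) \<le> M * x ^ m" if m: "1 \<le> m" for m
  proof (cases "NY phi = 0")
    case True
    then have "phi = (\<lambda>_. 0)" using Y.eqI[OF phi, of "\<lambda>_. 0"] by simp
    then have "L (replicate m phi) v = 0"
      using L_replicate_scale[OF phi, of m 0 v] m by (simp add: power_0_left split: if_splits)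
    then show ?thesis using M0 x by simp
  next
    case False
    then have pos: "NY phi > 0" using Y.nonneg[of phi] by linarith
    have "cmod (L (replicate m phi) v) \<le> M / (tau * rs / NY phi) ^ m"
      using pos tau rs_pos trs by (intro L_Cauchy_bound phi v m) auto
    then show ?thesis by (simp add: x_def power_divide)
  qed
  have "(\<lambda>j. L (replicate (Suc (j + N)) phi) v) sums (sol phi v - (\<Sum>i<N. L (replicate (Suc i) phi) v))"
    using L_sums_sol[OF phi] lt trs by (intro sums_split_initial_segment) auto
  then have s: "(\<lambda>j. L (replicate (Suc (j + N)) phi) v) sums (sol phi v - (\<Sum>m=1..N. L (replicate m phi) v))"
    by (simp add: sum.atLeast1_atMost_eq del: replicate_Suc)
  have g: "(\<lambda>j. M * x ^ Suc N * x ^ j) sums (M * x ^ Suc N * (1 / (1 - x)))"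
    using x by (intro sums_mult geometric_sums) auto
  have "cmod (sol phi v - (\<Sum>m=1..N. L (replicate m phi) v)) \<le> M * x ^ Suc N * (1 / (1 - x))"
  proof (rule norm_sums_le[OF s g])
    show "cmod (L (replicate (Suc (j + N)) phi) v) \<le> M * x ^ Suc N * x ^ j" for j
      using Lm[of "Suc (j + N)"] by (simp add: power_add mult_ac del: replicate_Suc)
  qed
  \<comment> \<open>The tail starts at order \<open>N + 1\<close>, so one spare factor
    \<open>x \<le> 1\<close> is dropped here.\<close>
  also have "\<dots> \<le> M * x ^ N * (1 / (1 - x))"
    using x M0 by (intro mult_right_mono mult_left_mono power_decreasing) auto
  finally show ?thesis by (simp add: x_def)
qed

end
end

section \<open>The Born operators\<close>

lemma fun_norm_lpnorm: "finite A \<Longrightarrow> 1 \<le> p \<Longrightarrow> fun_norm A (lpnorm A p)"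
  by unfold_locales (auto intro: lpnorm_triangle lpnorm_mult_left norm_le_lpnorm lpnorm_le_l1)

lemma gchain_lin:
  "gchain G V x (xs @ (\<lambda>v. a * f v + b * g v) # ys) y
    = a * gchain G V x (xs @ f # ys) y + b * gchain G V x (xs @ g # ys) y"
  by (induction xs arbitrary: x) (simp_all add: algebra_simps sum.distrib sum_distrib_left)

lemma Kop_mlin: "mlin A n (\<lambda>es. Kop G a V R S es z)"
  unfolding mlin_def Kop_def by (auto simp: gchain_lin algebra_simps split: prod.split)

lemma Kop_supp: "Kop G a V R S es \<in> supp_in (R \<times> S)"
  by (auto simp: Kop_def supp_in_def)

context
  fixes V :: "'a set" and p q :: ereal and G :: "'a \<Rightarrow> 'a \<Rightarrow> complex"
  assumes V: "finite V" and pq: "1 \<le> p" "1 \<le> q" "inverse p + inverse q = 1"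
begin

text \<open>One link of the chain: Hoelder's inequality for the pair \<open>g\<close>,
  \<open>e\<close>, once the rest of the chain is bounded by \<open>W\<close>.\<close>

lemma sum_weighted_bound:
  assumes "\<And>v. v \<in> V \<Longrightarrow> cmod (w v) \<le> W" "0 \<le> W"
  shows "cmod (\<Sum>v\<in>V. g v * e v * w v) \<le> lpnorm V q g * lpnorm V p e * W"
proof -
  have "cmod (\<Sum>v\<in>V. g v * e v * w v) \<le> (\<Sum>v\<in>V. cmod (g v) * cmod (e v) * W)"
    by (rule order_trans[OF norm_sum sum_mono]) (auto simp: norm_mult intro: mult_left_mono assms)
  also have "\<dots> \<le> lpnorm V q g * lpnorm V p e * W"
    unfolding sum_distrib_right[symmetric] by (intro mult_right_mono lpnorm_Holder V pq assms)
  finally show ?thesis .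
qed

text \<open>Each sum over \<open>V\<close> costs a row norm, at most \<open>m\<close>, and the norm
  of one potential. The chain ends with an entry of column \<open>y\<close>, bounded by the norm of
  that column.\<close>

lemma gchain_bound:
  assumes m: "\<And>v. v \<in> V \<Longrightarrow> lpnorm V q (G v) \<le> m"
  shows "x \<in> V \<Longrightarrow> cmod (gchain G V x es y)
    \<le> m ^ length es * prod_list (map (lpnorm V p) es) * lpnorm V q (\<lambda>v. G v y)"
proof (induction es arbitrary: x)
  case Nil
  then show ?case using norm_le_lpnorm[OF V pq(2) Nil, of "\<lambda>v. G v y"] by simp
next
  case (Cons e es)
  have nn: "0 \<le> m" using m[OF Cons.prems] lpnorm_nonneg[OF V] order_trans by blast
  let ?W = "m ^ length es * prod_list (map (lpnorm V p) es) * lpnorm V q (\<lambda>v. G v y)"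
  have W: "0 \<le> ?W" using nn by (intro mult_nonneg_nonneg prod_list_nonneg lpnorm_nonneg V) (auto intro: lpnorm_nonneg V)
  have "cmod (gchain G V x (e # es) y) \<le> lpnorm V q (G x) * lpnorm V p e * ?W"
    unfolding gchain.simps using Cons.IH W by (rule sum_weighted_bound)
  also have "\<dots> \<le> m * lpnorm V p e * ?W"
    by (intro mult_right_mono m Cons.prems W lpnorm_nonneg V)
  finally show ?case by (simp add: mult_ac)
qed

text \<open>The first sum starts at a receiver, whose row norm is kept as \<open>f r\<close>; the
  later sums start in \<open>V\<close> and cost \<open>m\<close> each. What remains is
  \<open>c * (f r * g s)\<close>, and the norm over \<open>R \<times> S\<close> of its variable part
  splits into the two factors of \<open>nu_p\<close>.\<close>

lemma Kop_bound:
  assumes "finite R" "finite S" and a: "a > 0" and es: "es \<noteq> []" and "V \<noteq> {}"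
  shows "lpnorm (R \<times> S) p (Kop G a V R S es)
    \<le> nu_p G a V R S p q * mu_p G a V q ^ (length es - 1) * prod_list (map (lpnorm V p) es)"
proof -
  define m where "m = Max ((\<lambda>v. lpnorm V q (\<lambda>w. G v w)) ` V)"
  have m: "lpnorm V q (G v) \<le> m" if "v \<in> V" for v
    unfolding m_def using V that by (intro Max_ge) auto
  have "m \<ge> 0" using m \<open>V \<noteq> {}\<close> lpnorm_nonneg[OF V] order_trans by blast
  obtain e es' where es': "es = e # es'" using es by (cases es) auto
  define c where "c = a ^ length es * m ^ length es' * prod_list (map (lpnorm V p) es)"
  have prod_nn: "0 \<le> prod_list (map (lpnorm V p) xs)" for xs :: "('a \<Rightarrow> complex) list"
    by (intro prod_list_nonneg) (auto intro: lpnorm_nonneg V)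
  have c: "c \<ge> 0" unfolding c_def using a \<open>m \<ge> 0\<close> prod_nn by simp
  define f where "f r = lpnorm V q (\<lambda>v. G r v)" for r
  define g where "g s = lpnorm V q (\<lambda>v. G v s)" for s
  have fg: "0 \<le> f x" "0 \<le> g x" for x unfolding f_def g_def by (auto intro: lpnorm_nonneg V)
  have "cmod (Kop G a V R S es (r, s)) \<le> c * (f r * g s)" if "r \<in> R" "s \<in> S" for r s
  proof -
    have "cmod (gchain G V r (e # es') s)
      \<le> lpnorm V q (G r) * lpnorm V p e * (m ^ length es' * prod_list (map (lpnorm V p) es') * g s)"
      unfolding gchain.simps g_def
      by (rule sum_weighted_bound[OF gchain_bound[OF m]])
         (use \<open>m \<ge> 0\<close> prod_nn in \<open>auto intro!: mult_nonneg_nonneg lpnorm_nonneg V\<close>)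
    then have "a ^ length es * cmod (gchain G V r es s) \<le> c * (f r * g s)"
      using a by (simp add: c_def es' f_def mult_ac)
    then show ?thesis using that a by (simp add: Kop_def norm_mult norm_power)
  qed
  then have "lpnorm (R \<times> S) p (Kop G a V R S es) \<le> lpnorm (R \<times> S) p (\<lambda>z. c * (case z of (r, s) \<Rightarrow> f r * g s))"
    using assms(1,2) c fg by (intro lpnorm_mono pq) (auto simp: abs_mult)
  also have "\<dots> = c * lpnorm (R \<times> S) p (\<lambda>(r, s). f r * g s)"
    using assms(1,2) c by (subst lpnorm_mult_left) (auto intro: pq)
  also have "\<dots> \<le> c * (lpnorm R p f * lpnorm S p g)"
    by (intro mult_left_mono lpnorm_prod_le assms pq c)
  also have "\<dots> = nu_p G a V R S p q * mu_p G a V q ^ (length es - 1) * prod_list (map (lpnorm V p) es)"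
    by (simp add: nu_p_def mu_p_def c_def es' f_def[abs_def] g_def[abs_def] m_def power_mult_distrib mult_ac)
  finally show ?thesis .
qed

end

section \<open>The inverse of the linear Born operator and the constant \<open>C_p\<close>\<close>

lemma K1inv_props:
  assumes "bij_betw (\<lambda>eta. Kop G a V R S [eta]) (supp_in V) (supp_in (R \<times> S))"
  shows K1inv_supp: "phi \<in> supp_in (R \<times> S) \<Longrightarrow> K1inv G a V R S phi \<in> supp_in V"
    and Kop_K1inv: "phi \<in> supp_in (R \<times> S) \<Longrightarrow> Kop G a V R S [K1inv G a V R S phi] = phi"
    and K1inv_Kop: "eta \<in> supp_in V \<Longrightarrow> K1inv G a V R S (Kop G a V R S [eta]) = eta"
proof -
  have inj: "e = e'" if "e \<in> supp_in V" "e' \<in> supp_in V" "Kop G a V R S [e] = Kop G a V R S [e']" for e e'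
    using assms that by (auto simp: bij_betw_def inj_on_def)
  have "\<exists>!eta. eta \<in> supp_in V \<and> Kop G a V R S [eta] = phi" if phi: "phi \<in> supp_in (R \<times> S)" for phi
  proof -
    from phi obtain e where "e \<in> supp_in V" "phi = Kop G a V R S [e]"
      using assms unfolding bij_betw_def by auto
    with inj show ?thesis by blast
  qed
  note ex = theI'[OF this, folded K1inv_def]
  show "K1inv G a V R S phi \<in> supp_in V" "Kop G a V R S [K1inv G a V R S phi] = phi"
    if "phi \<in> supp_in (R \<times> S)" for phi using ex[OF that] by auto
  show "K1inv G a V R S (Kop G a V R S [eta]) = eta" if "eta \<in> supp_in V"
    using ex[OF Kop_supp] inj that by blast
qed

text \<open>Pulling the unit data back through the inverse bounds the norm of \<open>eta\<close> by
  \<open>D\<close> times that of its image, hence a positive lower bound for the infimum without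
  compactness. The bound on the inverse follows by normalization: every quotient of the norms of
  image and argument belongs to the set \<open>S0\<close> whose infimum is
  \<open>C_p\<close>.\<close>

lemma C_p_bounds:
  assumes fin: "finite V" "finite R" "finite S" "V \<noteq> {}" and p: "1 \<le> p"
    and bij: "bij_betw (\<lambda>eta. Kop G a V R S [eta]) (supp_in V) (supp_in (R \<times> S))"
  shows C_p_pos: "C_p G a V R S p > 0"
    and K1inv_bound: "phi \<in> supp_in (R \<times> S) \<Longrightarrow>
      lpnorm V p (K1inv G a V R S phi) \<le> lpnorm (R \<times> S) p phi / C_p G a V R S p"
proof -
  let ?K = "\<lambda>eta. Kop G a V R S [eta]" and ?J = "K1inv G a V R S"
  interpret X: fun_norm V "lpnorm V p" by (rule fun_norm_lpnorm[OF fin(1) p])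
  interpret Y: fun_norm "R \<times> S" "lpnorm (R \<times> S) p" by (rule fun_norm_lpnorm) (use fin p in auto)
  note J = K1inv_supp[OF bij] Kop_K1inv[OF bij] K1inv_Kop[OF bij]
  define S0 where "S0 = {lpnorm (R \<times> S) p (?K eta) | eta. eta \<in> supp_in V \<and> lpnorm V p eta = 1}"
  have C: "C_p G a V R S p = Inf S0" by (simp add: C_p_def S0_def)
  have bdd: "bdd_below S0" by (rule bdd_belowI[of _ 0]) (auto simp: S0_def)
  have scale: "?K (\<lambda>v. c * eta v) = (\<lambda>z. c * ?K eta z)" if "eta \<in> supp_in V" for c eta
    using mlin_scale[OF Kop_mlin[of V "Suc 0"], of "[]" "[]" eta] that by auto
  have normalized: "lpnorm (R \<times> S) p (?K eta) / lpnorm V p eta \<in> S0"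
    if "eta \<in> supp_in V" "lpnorm V p eta \<noteq> 0" for eta
  proof -
    let ?e = "\<lambda>v. complex_of_real (1 / lpnorm V p eta) * eta v"
    have "lpnorm V p ?e = 1" using that X.nonneg[of eta] by (subst X.scale) (simp add: norm_divide)
    moreover have "lpnorm (R \<times> S) p (?K ?e) = lpnorm (R \<times> S) p (?K eta) / lpnorm V p eta"
      unfolding scale[OF that(1)] Y.scale using X.nonneg[of eta] by (simp add: norm_divide)
    moreover have "?e \<in> supp_in V" by (rule supp_in_scale[OF that(1)])
    ultimately show ?thesis unfolding S0_def by (metis (mono_tags, lifting) mem_Collect_eq)
  qed
  obtain v where "v \<in> V" using fin(4) by blast
  have "lpnorm V p (unit_fun v) \<noteq> 0"
    using X.component_le[OF \<open>v \<in> V\<close>, of "unit_fun v"] by (auto simp: unit_fun_def)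
  from normalized[OF unit_fun_supp_in[OF \<open>v \<in> V\<close>] this] have "S0 \<noteq> {}" by blast
  define D where "D = (\<Sum>z\<in>R \<times> S. lpnorm V p (?J (unit_fun z)))"
  have D: "D \<ge> 0" unfolding D_def by (intro sum_nonneg) auto
  have crude: "lpnorm V p eta \<le> lpnorm (R \<times> S) p (?K eta) * D" if eta: "eta \<in> supp_in V" for eta
  proof -
    \<comment> \<open>By linearity \<open>e\<close> has the same image under \<open>?K\<close> as
      \<open>eta\<close>, so applying the inverse to both identifies them.\<close>
    define e where "e = (\<lambda>v. \<Sum>z\<in>R \<times> S. ?K eta z * ?J (unit_fun z) v)"
    have e: "e \<in> supp_in V" unfolding e_def by (intro supp_in_sum supp_in_scale J(1) unit_fun_supp_in)
    have "?K e y = ?K eta y" for y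
    proof -
      have "?K e y = (\<Sum>z\<in>R \<times> S. ?K eta z * ?K (?J (unit_fun z)) y)"
        unfolding e_def
        using mlin_sum[OF Kop_mlin[of V "Suc 0" G a V R S y], of "[]" "[]" "R \<times> S" "\<lambda>z. ?J (unit_fun z)" "?K eta"] fin
        by (simp add: J(1) unit_fun_supp_in)
      also have "\<dots> = (\<Sum>z\<in>R \<times> S. ?K eta z * unit_fun z y)"
        by (intro sum.cong refl) (simp add: J(2) unit_fun_supp_in)
      also have "\<dots> = ?K eta y"
        using fun_cong[OF supp_in_expand[OF Y.finite_dom Kop_supp[of G a V R S "[eta]"]], of y] by simp
      finally show ?thesis .
    qed
    then have "?K e = ?K eta" by blast
    then have "e = eta" using J(3)[OF e] J(3)[OF eta] by metis
    have "lpnorm V p e \<le> (\<Sum>z\<in>R \<times> S. lpnorm V p (\<lambda>v. ?K eta z * ?J (unit_fun z) v))"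
      unfolding e_def by (rule X.sum_le)
    also have "\<dots> \<le> (\<Sum>z\<in>R \<times> S. lpnorm (R \<times> S) p (?K eta) * lpnorm V p (?J (unit_fun z)))"
      unfolding X.scale by (intro sum_mono mult_right_mono Y.component_le) auto
    finally show ?thesis by (simp add: \<open>e = eta\<close> D_def sum_distrib_left)
  qed
  have "1 / (D + 1) \<le> Inf S0"
  proof (rule cInf_greatest[OF \<open>S0 \<noteq> {}\<close>])
    fix x assume "x \<in> S0"
    then obtain eta where eta: "eta \<in> supp_in V" "lpnorm V p eta = 1" "x = lpnorm (R \<times> S) p (?K eta)"
      unfolding S0_def by auto
    have "1 \<le> x * D" "0 \<le> x" using crude[OF eta(1)] eta by auto
    then have "1 \<le> x * (D + 1)" by (simp add: distrib_left)
    then show "1 / (D + 1) \<le> x" using D by (simp add: divide_le_eq)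
  qed
  moreover have "1 / (D + 1) > 0" using D by simp
  ultimately show pos: "C_p G a V R S p > 0" unfolding C by linarith
  assume phi: "phi \<in> supp_in (R \<times> S)"
  show "lpnorm V p (?J phi) \<le> lpnorm (R \<times> S) p phi / C_p G a V R S p"
  proof (cases "lpnorm V p (?J phi) = 0")
    case True
    then show ?thesis using pos by simp
  next
    case False
    then have "C_p G a V R S p \<le> lpnorm (R \<times> S) p phi / lpnorm V p (?J phi)"
      using cInf_lower[OF normalized[OF J(1)[OF phi]] bdd] by (simp add: C J(2)[OF phi])
    moreover have "lpnorm V p (?J phi) > 0" using False X.nonneg[of "?J phi"] by linarith
    ultimately show ?thesis using pos by (simp add: field_simps)
  qed
qed

section \<open>The error bound for the inverse Born series\<close>

lemma lpnorm_infinity_le: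
  assumes "finite A" "A \<noteq> {}" "\<And>x. x \<in> A \<Longrightarrow> norm (f x) \<le> B"
  shows "lpnorm A \<infinity> f \<le> B"
  using assms by (simp add: lpnorm_infinity)

theorem mainTheorem7:
  fixes V dV R S :: "'a set" and a0 :: real and G0 :: "'a \<Rightarrow> 'a \<Rightarrow> complex"
    and p q :: ereal
    and nu mu Cp rp lamstar Rstar M :: real
  assumes "finite V" and "finite dV" and "V \<inter> dV = {}"
    and "R \<subseteq> dV" and "S \<subseteq> dV" and "R \<noteq> {}" and "S \<noteq> {}" and "a0 > 0"
    and "1 \<le> p" and "1 \<le> q" and "inverse p + inverse q = 1"
    and "card V = card (R \<times> S)"
    and "bij_betw (\<lambda>eta. Kop G0 a0 V R S [eta]) (supp_in V) (supp_in (R \<times> S))"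
    and nu_def: "nu = nu_p G0 a0 V R S p q"
    and mu_def: "mu = mu_p G0 a0 V q"
    and "nu > 0" and "mu > 0"
    and Cp_def: "Cp = C_p G0 a0 V R S p"
    and rp_def: "rp = Cp / mu * (1 - 2 * (nu / Cp) * (sqrt (1 + Cp / nu) - 1))"
    and lamstar_def: "lamstar = 1 + sqrt (1 + Cp / nu)"
    and Rstar_def: "Rstar = Cp / (mu * (Cp + nu * lamstar))"
    and M_def: "M = Sup {lpnorm V p (psi G0 a0 V R S phi) | phi.
                     phi \<in> supp_in (R \<times> S) \<and> lpnorm (R \<times> S) p phi < rp}"
  shows "bdd_above {lpnorm V p (psi G0 a0 V R S phi) | phi.
                     phi \<in> supp_in (R \<times> S) \<and> lpnorm (R \<times> S) p phi < rp}
    \<and> (\<forall>tau phi (N::nat). 0 < tau \<and> tau < 1 \<and> phi \<in> supp_in (R \<times> S)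
          \<and> lpnorm (R \<times> S) p phi < tau * rp \<and> 1 \<le> N \<longrightarrow>
          lpnorm V \<infinity> (\<lambda>v. psi G0 a0 V R S phi v - (\<Sum>m=1..N. IB G0 a0 V R S (replicate m phi) v))
            \<le> M * (1 / (1 - tau)) ^ card V * (lpnorm (R \<times> S) p phi / (tau * rp)) ^ N
                * (1 / (1 - lpnorm (R \<times> S) p phi / (tau * rp))))
    \<and> (\<forall>tau phi (N::nat) eta. 0 < tau \<and> tau < 1 \<and> phi \<in> supp_in (R \<times> S)
          \<and> lpnorm (R \<times> S) p phi < tau * rp \<and> 1 \<le> N
          \<and> eta \<in> supp_in V \<and> lpnorm V p eta < Rstar
          \<and> (\<forall>x. (\<lambda>j. Kop G0 a0 V R S (replicate (Suc j) eta) x) sums phi x) \<longrightarrow>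
          lpnorm V \<infinity> (\<lambda>v. eta v - (\<Sum>m=1..N. IB G0 a0 V R S (replicate m phi) v))
            \<le> M * (1 / (1 - tau)) ^ card V * (lpnorm (R \<times> S) p phi / (tau * rp)) ^ N
                * (1 / (1 - lpnorm (R \<times> S) p phi / (tau * rp))))"
proof -
  have RS: "finite R" "finite S" "finite (R \<times> S)"
    using assms(2,4,5) by (auto intro: finite_subset)
  then have V: "V \<noteq> {}" using assms(6,7,12) by (auto simp: card_cartesian_product)
  note bij = assms(13)
  have Cp: "Cp > 0" unfolding Cp_def by (rule C_p_pos[OF assms(1) RS(1,2) V assms(9) bij])
  interpret fun_norm V "lpnorm V p" by (rule fun_norm_lpnorm[OF assms(1,9)])
  interpret Y: fun_norm "R \<times> S" "lpnorm (R \<times> S) p" by (rule fun_norm_lpnorm[OF RS(3) assms(9)])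
  interpret inverse_born V "lpnorm V p" "R \<times> S" "lpnorm (R \<times> S) p" "Kop G0 a0 V R S" "K1inv G0 a0 V R S"
    nu mu Cp "IB G0 a0 V R S"
  proof unfold_locales
    show "lpnorm (R \<times> S) p (Kop G0 a0 V R S es) \<le> nu * mu ^ (length es - 1) * prod_list (map (lpnorm V p) es)"
      if "es \<noteq> []" for es
      unfolding nu_def mu_def by (rule Kop_bound[OF assms(1,9-11) RS(1,2) assms(8) that V])
    show "lpnorm V p (K1inv G0 a0 V R S phi) \<le> lpnorm (R \<times> S) p phi / Cp" if "phi \<in> supp_in (R \<times> S)" for phi
      unfolding Cp_def by (rule K1inv_bound[OF assms(1) RS(1,2) V assms(9) bij that])
    show "IB G0 a0 V R S [phi] = K1inv G0 a0 V R S phi" for phi by (subst IB.simps) simp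
    show "IB G0 a0 V R S phis = (\<lambda>v. - (\<Sum>m\<in>{1..<length phis}. \<Sum>c\<in>comps m (length phis).
        IB G0 a0 V R S (map (\<lambda>ch. Kop G0 a0 V R S (map (K1inv G0 a0 V R S) ch)) (chunks c phis)) v))"
      if "2 \<le> length phis" for phis
      using that by (subst IB.simps) (auto simp del: IB.simps)
  qed (use Cp assms(16,17) K1inv_supp[OF bij] Kop_K1inv[OF bij] K1inv_Kop[OF bij] in \<open>auto simp: Kop_mlin Kop_supp\<close>)
  \<comment> \<open>With \<open>Cp = nu * (s\<^sup>2 - 1)\<close> the stated constants
    \<open>rp\<close> and \<open>Rstar\<close> simplify to \<open>rs\<close> and \<open>Rs\<close>;
    for the latter a common factor \<open>nu * (s + 1)\<close> cancels.\<close>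
  define s where "s = sqrt (1 + Cp / nu)"
  have s: "s > 1" using sqrt_gt_1 by (simp add: s_def)
  have "s\<^sup>2 = 1 + Cp / nu" using Cp assms(16) by (simp add: s_def)
  then have Cs: "Cp = nu * (s\<^sup>2 - 1)" using assms(16) by simp
  have "Cp * (1 - 2 * (nu / Cp) * (s - 1)) = Cp - 2 * nu * (s - 1)" using Cp by (simp add: right_diff_distrib)
  then have "rp = (Cp - 2 * nu * (s - 1)) / mu" unfolding rp_def s_def by simp
  also have "Cp - 2 * nu * (s - 1) = nu * (s - 1)\<^sup>2" by (subst Cs) (simp add: power2_eq_square algebra_simps)
  finally have rp: "rp = rs" by (simp add: rs_def s_def)
  have "Cp + nu * lamstar = nu * s * (s + 1)" by (subst Cs) (simp add: lamstar_def s_def[symmetric] power2_eq_square algebra_simps)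
  then have "Rstar = nu * (s\<^sup>2 - 1) / (mu * (nu * s * (s + 1)))" unfolding Rstar_def by (simp flip: Cs)
  also have "\<dots> = (s - 1) / (mu * s)"
  proof -
    have "nu * (s\<^sup>2 - 1) = (nu * (s + 1)) * (s - 1)" by (simp add: power2_eq_square algebra_simps)
    moreover have "mu * (nu * s * (s + 1)) = (nu * (s + 1)) * (mu * s)" by simp
    moreover have "nu * (s + 1) \<noteq> 0" using assms(16) s by simp
    ultimately show ?thesis by (metis mult_divide_mult_cancel_left)
  qed
  finally have Rstar: "Rstar = Rs" by (simp add: Rs_def s_def)
  have psi: "psi G0 a0 V R S phi = sol phi" if "phi \<in> supp_in (R \<times> S)" "lpnorm (R \<times> S) p phi < rp" for phi
    using L_sums_sol[OF that(1)] that(2) by (auto simp: psi_def rp sums_iff)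
  \<comment> \<open>Every solution with data of norm below \<open>rp\<close> lies in the ball of
    radius \<open>Rs\<close>, so \<open>Rs\<close> is an upper bound.\<close>
  have bdd: "bdd_above {lpnorm V p (psi G0 a0 V R S phi) | phi.
                     phi \<in> supp_in (R \<times> S) \<and> lpnorm (R \<times> S) p phi < rp}"
    by (rule bdd_aboveI[of _ Rs]) (use psi sol_ball_Rs in \<open>auto simp: rp intro: less_imp_le\<close>)
  have M: "lpnorm V p (sol phi) \<le> M" if "phi \<in> supp_in (R \<times> S)" "lpnorm (R \<times> S) p phi < rs" for phi
  proof -
    have "lpnorm V p (psi G0 a0 V R S phi) \<le> M"
      unfolding M_def by (rule cSup_upper[OF _ bdd]) (use that in \<open>auto simp: rp\<close>)
    then show ?thesis using psi that by (simp add: rp)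
  qed
  have "0 \<le> M" using M[of "\<lambda>_. 0"] rs_pos by (simp add: order_trans[OF nonneg])
  have error: "lpnorm V \<infinity> (\<lambda>v. sol phi v - (\<Sum>m=1..N. IB G0 a0 V R S (replicate m phi) v))
      \<le> M * (1 / (1 - tau)) ^ card V * (lpnorm (R \<times> S) p phi / (tau * rp)) ^ N
                * (1 / (1 - lpnorm (R \<times> S) p phi / (tau * rp)))"
    if "0 < tau" "tau < 1" "phi \<in> supp_in (R \<times> S)" "lpnorm (R \<times> S) p phi < tau * rp" "1 \<le> N" for tau phi N
  proof -
    define x where "x = lpnorm (R \<times> S) p phi / (tau * rp)"
    have x: "0 \<le> x" "x < 1" using that rs_pos by (auto simp: x_def rp)
    have "lpnorm V \<infinity> (\<lambda>v. sol phi v - (\<Sum>m=1..N. IB G0 a0 V R S (replicate m phi) v))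
      \<le> M * x ^ N * (1 / (1 - x))"
      unfolding x_def rp using that
      by (intro lpnorm_infinity_le assms(1) V sol_partial_sum_error M) (auto simp: rp)
    also have "\<dots> = 1 * (M * x ^ N * (1 / (1 - x)))" by simp
    also have "\<dots> \<le> (1 / (1 - tau)) ^ card V * (M * x ^ N * (1 / (1 - x)))"
    proof (rule mult_right_mono)
      show "1 \<le> (1 / (1 - tau)) ^ card V" using that by (intro one_le_power) simp
      show "0 \<le> M * x ^ N * (1 / (1 - x))" using \<open>0 \<le> M\<close> x by simp
    qed
    finally show ?thesis by (simp add: x_def mult_ac)
  qed
  have lt: "lpnorm (R \<times> S) p phi < rp" if "0 < tau" "tau < 1" "lpnorm (R \<times> S) p phi < tau * rp"
    for tau and phi :: "'a \<times> 'a \<Rightarrow> complex"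
  proof -
    have "tau * rp < rp" using that rs_pos by (simp add: rp)
    with that show ?thesis by linarith
  qed
  \<comment> \<open>Splitting off the first-order term turns the hypothesis on the data of
    \<open>eta\<close> into the scattering equation. Then \<open>eta\<close> and
    \<open>sol phi\<close> are both fixed points of \<open>step phi\<close> of norm below
    \<open>Rs\<close>, where fixed points are unique.\<close>
  have eta: "eta = sol phi"
    if phi: "phi \<in> supp_in (R \<times> S)" "lpnorm (R \<times> S) p phi < rp"
      and eta: "eta \<in> supp_in V" "lpnorm V p eta < Rstar"
      and sums: "\<forall>x. (\<lambda>j. Kop G0 a0 V R S (replicate (Suc j) eta) x) sums phi x" for phi eta
  proof -
    have "mu * lpnorm V p eta < 1" using less_Rs(1)[OF nonneg, of eta] eta(2) by (simp add: Rstar)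
    from K1_add_G_sums[OF eta(1) this] have "Kop G0 a0 V R S [eta] y + G eta y = phi y" for y
      using sums sums_unique2 by blast
    then have fixed: "step phi eta = eta" using step_fixed_iff[OF phi(1) eta(1)] by simp
    obtain rho where rho: "0 \<le> rho" "rho < Rs" "lpnorm (R \<times> S) p phi \<le> major rho"
      using obtain_rho phi(2) unfolding rp by blast
    show ?thesis
      using step_fixed_unique[OF phi(1) eta(1) sol_supp[OF phi(1)] _ _ fixed sol_fixed[OF phi(1) rho(3,1,2)]]
        eta(2) sol_ball_Rs[OF phi(1)] phi(2) by (simp add: rp Rstar)
  qed
  show ?thesis
  proof (intro conjI allI impI; (elim conjE)?)
    show "bdd_above {lpnorm V p (psi G0 a0 V R S phi) | phi.
                     phi \<in> supp_in (R \<times> S) \<and> lpnorm (R \<times> S) p phi < rp}" by (rule bdd)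
  next
    fix tau :: real and phi :: "'a \<times> 'a \<Rightarrow> complex" and N :: nat
    assume *: "0 < tau" "tau < 1" "phi \<in> supp_in (R \<times> S)" "lpnorm (R \<times> S) p phi < tau * rp" "1 \<le> N"
    show "lpnorm V \<infinity> (\<lambda>v. psi G0 a0 V R S phi v - (\<Sum>m=1..N. IB G0 a0 V R S (replicate m phi) v))
      \<le> M * (1 / (1 - tau)) ^ card V * (lpnorm (R \<times> S) p phi / (tau * rp)) ^ N
                * (1 / (1 - lpnorm (R \<times> S) p phi / (tau * rp)))"
      unfolding psi[OF *(3) lt[OF *(1,2,4)]] by (rule error[OF *])
  next
    fix tau :: real and phi :: "'a \<times> 'a \<Rightarrow> complex" and N :: nat and eta :: "'a \<Rightarrow> complex"
    assume *: "0 < tau" "tau < 1" "phi \<in> supp_in (R \<times> S)" "lpnorm (R \<times> S) p phi < tau * rp" "1 \<le> N"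
      and **: "eta \<in> supp_in V" "lpnorm V p eta < Rstar"
        "\<forall>x. (\<lambda>j. Kop G0 a0 V R S (replicate (Suc j) eta) x) sums phi x"
    show "lpnorm V \<infinity> (\<lambda>v. eta v - (\<Sum>m=1..N. IB G0 a0 V R S (replicate m phi) v))
      \<le> M * (1 / (1 - tau)) ^ card V * (lpnorm (R \<times> S) p phi / (tau * rp)) ^ N
                * (1 / (1 - lpnorm (R \<times> S) p phi / (tau * rp)))"
      unfolding eta[OF *(3) lt[OF *(1,2,4)] **] by (rule error[OF *])
  qed
qed

end
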